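(* Let $H^2(\mathbb{D})$ be the Hardy space of the unit disc. A linear map $\tilde R:H^2(\mathbb{D})\to H^2(\mathbb{D})$ is a bounded radial operator if and only if there exists a distribution $u\in\mathcal{D}'(\mathbb{T})$ with $(\hat u(m))_{m\in\mathbb{Z}_+}\in\ell^\infty(\mathbb{Z}_+)$ which induces an analytic function $g$ on $\mathbb{D}$ such that $$\tilde Rf(z)=\hat u(0)f(0)+z\int_{\mathbb{D}}f'(w)\,g'(z\bar w)\log\frac{1}{|w|^2}\,dA(w)\quad\text{for all } f\in H^2(\mathbb{D}),\ z\in\mathbb{D}.$$
   Context: $\mathbb{D}$ is the open unit disc, $dA$ the normalized area measure, $\mathbb{Z}_+=\{0,1,2,\dots\}$. $H^2(\mathbb{D})$ is the Hardy–Hilbert space, whose norm satisfies $\|f\|^2=|f(0)|^2+\int_{\mathbb{D}}|f'(z)|^2\log\frac{1}{|z|^2}\,dA(z)$; here $\|z^m\|=1$ for all $m\ge0$. For $\lambda\in\mathbb{T}$, $V_\lambda f(z)=f(\lambda z)$; a bounded $\tilde R$ is radial if $\tilde RV_\lambda=V_\lambda\tilde R$ for all $\lambda\in\mathbb{T}$. $\mathcal{D}'(\mathbb{T})$ is the space of periodic distributions with Fourier coefficients $\hat u(m)$. Induced functions are defined as for weighted Bergman spaces with the $H^2$ norm: for $0\le r<1$, $K_r$ is the distribution $\sum_{m\ge0}\|z^m\|^{-2}r^me^{im\theta}=\sum_{m\ge0}r^me^{im\theta}$, and $g$ is induced by $u$ if for every $r\in[0,1)$, $\theta\mapsto g(re^{i\theta})$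 is the sum of the Fourier series of $K_r*u$, i.e. $g(z)=\sum_{m\ge0}\hat u(m)z^m$. *)

theory Defs
  imports "HOL-Analysis.Analysis"
begin

text \<open>Elements of H^2 are analytic functions on the unit disc. We represent them as
  functions on the whole complex plane that vanish outside the open unit disc
  (so that equality of elements is plain equality of functions).\<close>

definition H2_weight :: "complex \<Rightarrow> real" where
  "H2_weight w = ln (1 / (cmod w)\<^sup>2)"

definition H2 :: "(complex \<Rightarrow> complex) set" where
  "H2 = {f. f holomorphic_on ball 0 1
           \<and> (\<forall>z. z \<notin> ball 0 1 \<longrightarrow> f z = 0)
           \<and> set_integrable lborel (ball 0 1) (\<lambda>w. (cmod (deriv f w))\<^sup>2 * H2_weight w)}"

text \<open>Norm: ||f||^2 = |f(0)|^2 + int_D |f'|^2 log(1/|w|^2) dA, with dA = dx dy / pi.\<close>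
definition H2_norm :: "(complex \<Rightarrow> complex) \<Rightarrow> real" where
  "H2_norm f = sqrt ((cmod (f 0))\<^sup>2
       + (LINT w:ball 0 1|lborel. (cmod (deriv f w))\<^sup>2 * H2_weight w) / pi)"

definition rot :: "complex \<Rightarrow> (complex \<Rightarrow> complex) \<Rightarrow> (complex \<Rightarrow> complex)" where
  "rot l f = (\<lambda>z. f (l * z))"

definition H2_linear :: "((complex \<Rightarrow> complex) \<Rightarrow> (complex \<Rightarrow> complex)) \<Rightarrow> bool" where
  "H2_linear R \<longleftrightarrow> (\<forall>f\<in>H2. R f \<in> H2)
     \<and> (\<forall>f\<in>H2. \<forall>g\<in>H2. R (\<lambda>z. f z + g z) = (\<lambda>z. R f z + R g z))
     \<and> (\<forall>f\<in>H2. \<forall>c. R (\<lambda>z. c * f z) = (\<lambda>z. c * R f z))"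

definition H2_bounded :: "((complex \<Rightarrow> complex) \<Rightarrow> (complex \<Rightarrow> complex)) \<Rightarrow> bool" where
  "H2_bounded R \<longleftrightarrow> (\<exists>C. \<forall>f\<in>H2. H2_norm (R f) \<le> C * H2_norm f)"

definition H2_radial :: "((complex \<Rightarrow> complex) \<Rightarrow> (complex \<Rightarrow> complex)) \<Rightarrow> bool" where
  "H2_radial R \<longleftrightarrow> (\<forall>l. cmod l = 1 \<longrightarrow> (\<forall>f\<in>H2. R (rot l f) = rot l (R f)))"

fun nderiv :: "nat \<Rightarrow> (real \<Rightarrow> complex) \<Rightarrow> (real \<Rightarrow> complex)" where
  "nderiv 0 \<phi> = \<phi>"
| "nderiv (Suc k) \<phi> = (\<lambda>x. vector_derivative (nderiv k \<phi>) (at x))"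

definition test_fun :: "(real \<Rightarrow> complex) \<Rightarrow> bool" where
  "test_fun \<phi> \<longleftrightarrow> (\<forall>x. \<phi> (x + 2 * pi) = \<phi> x)
      \<and> (\<forall>k x. nderiv k \<phi> differentiable (at x))"

text \<open>A periodic distribution: a linear functional on test functions, continuous for the
  C^infinity topology, i.e. bounded by finitely many sup-seminorms of derivatives.\<close>
definition periodic_distribution :: "((real \<Rightarrow> complex) \<Rightarrow> complex) \<Rightarrow> bool" where
  "periodic_distribution u \<longleftrightarrow>
     (\<forall>\<phi> \<psi> a b. test_fun \<phi> \<longrightarrow> test_fun \<psi> \<longrightarrow>
        u (\<lambda>x. a * \<phi> x + b * \<psi> x) = a * u \<phi> + b * u \<psi>)
   \<and> (\<exists>C N. \<forall>\<phi>. test_fun \<phi> \<longrightarrow>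
        cmod (u \<phi>) \<le> C * (\<Sum>k\<le>N. Sup (range (\<lambda>x. cmod (nderiv k \<phi> x)))))"

definition fourier_coeff :: "((real \<Rightarrow> complex) \<Rightarrow> complex) \<Rightarrow> int \<Rightarrow> complex" where
  "fourier_coeff u m = u (\<lambda>\<theta>. exp (- \<i> * of_int m * of_real \<theta>))"

text \<open>g is induced by u: g(z) = sum_{m>=0} hat u(m) z^m on the disc
  (equivalently, g(r e^{i theta}) is the sum of the Fourier series of K_r * u).\<close>
definition induces :: "((real \<Rightarrow> complex) \<Rightarrow> complex) \<Rightarrow> (complex \<Rightarrow> complex) \<Rightarrow> bool" where
  "induces u g \<longleftrightarrow> (\<forall>z\<in>ball 0 1. (\<lambda>m. fourier_coeff u (int m) * z ^ m) sums g z)"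

end

theory Submission
  imports Defs "HOL-Complex_Analysis.Complex_Analysis" "HOL-Real_Asymp.Real_Asymp"
begin

text \<open>Write \<open>f = \<Sum> a\<^sub>m z\<^sup>m\<close>. Averaging \<open>|f'|\<^sup>2\<close> over rotations (Tonelli and rotation invariance of area)
  reduces the \<open>H\<^sup>2\<close> norm to the radial moments \<open>\<integral> |w|\<^sup>2\<^sup>n log (1/|w|\<^sup>2) dA = 1/(n+1)\<^sup>2\<close>, which gives
  \<open>\<parallel>f\<parallel>\<^sup>2 = \<Sum> |a\<^sub>m|\<^sup>2\<close>, and by polarization shows that the integral operator attached to
  \<open>g = \<Sum> c\<^sub>m z\<^sup>m\<close> is the multiplier \<open>a\<^sub>m \<mapsto> c\<^sub>m a\<^sub>m\<close>. Such a multiplier with bounded \<open>c\<close> is bounded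
  and radial. Conversely, a radial operator maps \<open>z\<^sup>m\<close> to a multiple \<open>c\<^sub>m z\<^sup>m\<close>; boundedness bounds
  \<open>c\<close> and extends the multiplier formula from polynomials to all of \<open>H\<^sup>2\<close>.\<close>

subsection \<open>Area measure and rotations\<close>

text \<open>The moment \<open>1/(n+1)^2\<close> cancels the two factors \<open>n+1\<close>
  contributed by a pair of differentiated power series; this makes the norm a plain l^2 norm and the
  operator diagonal on monomials. The obstacle is that a symbol \<open>g\<close> with merely bounded
  coefficients need not lie in H^2, so a polarized identity for pairs of H^2 functions does not
  cover it. Hence \<open>f'\<close> is tested only against powers of the conjugate of
  \<open>w\<close>: for fixed \<open>z\<close> in the open disc, \<open>g'(z * cnj w)\<close> is a
  series of such powers with absolutely summable coefficients, dominated uniformly in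
  \<open>w\<close>. A second obstacle is that linearity of the operator reaches only finite sums, so
  its action on a general \<open>f\<close> is obtained by stripping off monomials one at a time and
  controlling the remaining tail in norm. The distribution exists for every bounded sequence because
  division by \<open>m^2\<close> makes the sequence summable.\<close>

lemma nn_integral_lborel_translate:
  fixes a :: "'a::euclidean_space"
  assumes [measurable]: "f \<in> borel_measurable borel"
  shows "(\<integral>\<^sup>+x. f (a + x) \<partial>lborel) = (\<integral>\<^sup>+x. f x \<partial>lborel)"
proof -
  have "(\<integral>\<^sup>+x. f x \<partial>lborel) = (\<integral>\<^sup>+x. f x \<partial>distr lborel borel ((+) a))"
    by (simp add: lborel_distr_plus)
  also have "\<dots> = (\<integral>\<^sup>+x. f (a + x) \<partial>lborel)"
    by (subst nn_integral_distr) auto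
  finally show ?thesis ..
qed

text \<open>Uniqueness of Haar measure: by translation invariance of both measures, Tonelli evaluates
  \<open>\<integral>\<integral> 1\<^sub>A(x) 1\<^sub>B(f y) dy dx\<close> in two ways, and the unit ball \<open>B\<close> is preserved by \<open>f\<close>.\<close>

lemma lborel_distr_orthogonal_transformation:
  fixes f :: "'a::euclidean_space \<Rightarrow> 'a"
  assumes f: "orthogonal_transformation f"
  shows "distr lborel borel f = lborel"
proof (rule measure_eqI)
  have lin: "linear f"
    using f by (rule orthogonal_transformation_linear)
  have f_meas [measurable]: "f \<in> borel_measurable borel"
    by (intro borel_measurable_continuous_onI linear_continuous_on linear_conv_bounded_linear[THEN iffD1] lin)
  fix A :: "'a set" assume "A \<in> sets (distr lborel borel f)"
  then have A [measurable]: "A \<in> sets borel" by simp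
  define B where "B = ball (0::'a) 1"
  have B [measurable]: "B \<in> sets borel" by (simp add: B_def)
  have fB: "f y \<in> B \<longleftrightarrow> y \<in> B" for y
    using orthogonal_transformation_norm[OF f] by (simp add: B_def)
  have mB: "- y \<in> B \<longleftrightarrow> y \<in> B" for y
    by (simp add: B_def)
  \<comment> \<open>Surjectivity converts a translation applied after \<open>f\<close> into a
    translation of the integration variable, which leaves Lebesgue measure unchanged.\<close>
  have shift: "\<exists>z. \<forall>y. f (z + y) = f y + x" for x
  proof -
    obtain z where "f z = x"
      using orthogonal_transformation_surj[OF f] by (metis surjD)
    then show ?thesis
      by (intro exI[of _ z]) (simp add: linear_add[OF lin] add.commute)
  qed
  have "emeasure lborel B * emeasure lborel A
      = (\<integral>\<^sup>+x. \<integral>\<^sup>+y. indicator A x * indicator B (f y) \<partial>lborel \<partial>lborel)"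
  proof -
    have "(\<integral>\<^sup>+y. indicator B (f y) \<partial>lborel) = emeasure lborel B"
      by (subst nn_integral_indicator[symmetric], simp add: B_def, intro nn_integral_cong)
        (simp add: indicator_def fB)
    then show ?thesis
      by (simp add: nn_integral_cmult nn_integral_multc mult.commute)
  qed
  also have "\<dots> = (\<integral>\<^sup>+x. \<integral>\<^sup>+y. indicator A x * indicator B (f y - x) \<partial>lborel \<partial>lborel)"
  proof (rule nn_integral_cong)
    fix x
    obtain z where z: "\<And>y. f (z + y) = f y + (- x)" using shift by blast
    show "(\<integral>\<^sup>+y. indicator A x * indicator B (f y) \<partial>lborel)
        = (\<integral>\<^sup>+y. indicator A x * indicator B (f y - x) \<partial>lborel)"
      by (subst nn_integral_lborel_translate[symmetric, of _ z]) (simp_all add: z)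
  qed
  also have "\<dots> = (\<integral>\<^sup>+y. \<integral>\<^sup>+x. indicator A x * indicator B (f y - x) \<partial>lborel \<partial>lborel)"
    by (rule lborel_pair.Fubini') simp
  \<comment> \<open>Translating \<open>x\<close> by \<open>f y\<close> moves the shift from
    \<open>B\<close> to \<open>A\<close> and leaves \<open>- x\<close> in \<open>B\<close>, hence
    the symmetry \<open>mB\<close> of the ball.\<close>
  also have "\<dots> = (\<integral>\<^sup>+y. \<integral>\<^sup>+x. indicator A (f y + x) * indicator B x \<partial>lborel \<partial>lborel)"
  proof (rule nn_integral_cong)
    fix y
    show "(\<integral>\<^sup>+x. indicator A x * indicator B (f y - x) \<partial>lborel)
        = (\<integral>\<^sup>+x. indicator A (f y + x) * indicator B x \<partial>lborel)"
      by (rule trans[OF nn_integral_lborel_translate[symmetric, where a = "f y"]])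
        (simp_all add: indicator_def mB)
  qed
  also have "\<dots> = (\<integral>\<^sup>+x. \<integral>\<^sup>+y. indicator A (f y + x) * indicator B x \<partial>lborel \<partial>lborel)"
    by (rule lborel_pair.Fubini') simp
  also have "\<dots> = (\<integral>\<^sup>+x. \<integral>\<^sup>+y. indicator A (f y) * indicator B x \<partial>lborel \<partial>lborel)"
  proof (rule nn_integral_cong)
    fix x
    obtain z where z: "\<And>y. f (z + y) = f y + x" using shift by blast
    show "(\<integral>\<^sup>+y. indicator A (f y + x) * indicator B x \<partial>lborel)
        = (\<integral>\<^sup>+y. indicator A (f y) * indicator B x \<partial>lborel)"
      by (subst (2) nn_integral_lborel_translate[symmetric, of _ z]) (simp_all add: z)
  qed
  also have "\<dots> = emeasure lborel B * (\<integral>\<^sup>+y. indicator A (f y) \<partial>lborel)"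
    by (simp add: nn_integral_cmult nn_integral_multc mult.commute)
  also have "(\<integral>\<^sup>+y. indicator A (f y) \<partial>lborel) = emeasure (distr lborel borel f) A"
    by (subst nn_integral_indicator[symmetric], simp, subst nn_integral_distr) simp_all
  finally have "emeasure lborel B * emeasure lborel A
      = emeasure lborel B * emeasure (distr lborel borel f) A" .
  moreover have "emeasure lborel B \<noteq> 0" "emeasure lborel B \<noteq> \<infinity>"
    using unit_ball_vol_pos[of "real DIM('a)"] by (simp_all add: B_def emeasure_ball del: unit_ball_vol_pos)
  ultimately show "emeasure (distr lborel borel f) A = emeasure lborel A"
    by (simp add: ennreal_mult_cancel_left)
qed simp

lemma orthogonal_transformation_complex_mult:
  assumes "cmod l = 1"
  shows "orthogonal_transformation ((*) l)"
  unfolding orthogonal_transformation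
  using assms by (simp add: norm_mult linear_times)

text \<open>The disc of radius \<open>sqrt x\<close> has area \<open>pi * x\<close>, so the variable
  \<open>t = |w|^2\<close> is uniform on [0,1] with total mass \<open>pi\<close>. Comparing both
  measures on half-lines suffices. This takes the place of polar coordinates for radial
  integrands.\<close>

lemma distr_cmod_square_ball:
  "distr (restrict_space lborel (ball 0 1)) borel (\<lambda>w::complex. (cmod w)\<^sup>2)
     = density lborel (\<lambda>t. ennreal pi * indicator {0..1} t)"
proof (rule measure_eqI_lessThan)
  have m: "(\<lambda>w::complex. (cmod w)\<^sup>2) \<in> borel_measurable (restrict_space lborel (ball 0 1))"
    by (intro measurable_restrict_space1) simp
  have em: "emeasure (distr (restrict_space lborel (ball 0 1)) borel (\<lambda>w::complex. (cmod w)\<^sup>2)) {x<..}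
      = emeasure lborel (ball (0::complex) 1 - cball 0 (sqrt x))" if "0 \<le> x" for x
  proof -
    have "cmod w \<le> sqrt x \<longleftrightarrow> (cmod w)\<^sup>2 \<le> x" for w
      by (metis real_sqrt_le_iff real_sqrt_abs abs_norm_cancel)
    then have "(\<lambda>w::complex. (cmod w)\<^sup>2) -` {x<..} \<inter> ball 0 1 = ball 0 1 - cball 0 (sqrt x)"
      by auto
    then show ?thesis
      by (subst emeasure_distr[OF m], simp, subst emeasure_restrict_space)
        (auto simp: space_restrict_space)
  qed
  have vol: "emeasure lborel (ball (0::complex) 1 - cball 0 (sqrt x)) = ennreal (pi * (1 - x))"
    if "0 \<le> x" "x < 1" for x
  proof -
    have "emeasure lborel (ball (0::complex) 1 - cball 0 (sqrt x))
       = emeasure lborel (ball (0::complex) 1) - emeasure lborel (cball (0::complex) (sqrt x))"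
      using that order.strict_trans1[of _ "sqrt x" 1]
      by (intro emeasure_Diff) (auto simp: emeasure_cball)
    also have "\<dots> = ennreal (pi * (1 - x))"
      using that by (simp add: emeasure_ball emeasure_cball ennreal_minus unit_ball_vol_numeral algebra_simps)
    finally show ?thesis .
  qed
  have em0: "emeasure (distr (restrict_space lborel (ball 0 1)) borel (\<lambda>w::complex. (cmod w)\<^sup>2)) {x<..}
      = ennreal pi" if "x < 0" for x
  proof -
    have "(\<lambda>w::complex. (cmod w)\<^sup>2) -` {x<..} \<inter> ball 0 1 = ball 0 1"
      by (auto intro: less_le_trans[OF that zero_le_power2])
    then show ?thesis
      by (subst emeasure_distr[OF m], simp, subst emeasure_restrict_space)
        (auto simp: space_restrict_space emeasure_ball unit_ball_vol_numeral)
  qed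
  have ed: "emeasure (density lborel (\<lambda>t. ennreal pi * indicator {0..1} t)) {x<..}
     = ennreal pi * emeasure lborel ({0..1} \<inter> {x<..})" for x :: real
    by (subst emeasure_density) (auto simp: mult.assoc nn_integral_cmult simp flip: indicator_inter_arith)
  fix x :: real
  show eq: "emeasure (distr (restrict_space lborel (ball 0 1)) borel (\<lambda>w::complex. (cmod w)\<^sup>2)) {x<..}
     = emeasure (density lborel (\<lambda>t. ennreal pi * indicator {0..1} t)) {x<..}"
  proof -
    consider "x < 0" | "0 \<le> x" "x < 1" | "x \<ge> 1" by linarith
    then show ?thesis
    proof cases
      case 1
      then have "{0..1} \<inter> {x<..} = {0..1}" by auto
      then show ?thesis unfolding em0[OF 1] ed by simp
    next
      case 2
      then have "{0..1} \<inter> {x<..} = {x<..1}" by auto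
      then show ?thesis unfolding em[OF 2(1)] vol[OF 2] ed using 2
        by (simp add: ennreal_mult)
    next
      case 3
      then have sq: "1 \<le> sqrt x" by simp
      have "{0..1} \<inter> {x<..} = {}" and e: "ball (0::complex) 1 - cball 0 (sqrt x) = {}"
        using 3 by (auto intro: order.trans[OF less_imp_le sq])
      moreover have "0 \<le> x" using 3 by simp
      ultimately show ?thesis by (simp only: em ed) simp
    qed
  qed
  show "emeasure (distr (restrict_space lborel (ball 0 1)) borel (\<lambda>w::complex. (cmod w)\<^sup>2)) {x<..} < \<infinity>"
  proof -
    have "emeasure lborel ({0..1} \<inter> {x<..}) < \<infinity>"
      using emeasure_mono[of "{0..1} \<inter> {x<..}" "{0..1}" lborel] by (rule le_less_trans) simp_all
    then show ?thesis
      unfolding eq ed by (simp add: ennreal_mult_less_top)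
  qed
qed simp_all

lemma nn_integral_power_ln:
  "(\<integral>\<^sup>+t\<in>{0..1}. ennreal (t ^ n * ln (1 / t)) \<partial>lborel) = ennreal (1 / (real n + 1)\<^sup>2)"
proof -
  \<comment> \<open>The antiderivative found by integrating by parts; \<open>G 0 = 0\<close> and
    \<open>G 1\<close> is the claimed value.\<close>
  define G where "G = (\<lambda>t::real. t ^ (n + 1) * (1 - (n + 1) * ln t) / (real n + 1)\<^sup>2)"
  have "continuous_on {0..1} G"
  proof (rule continuous_on_eq_continuous_within[THEN iffD2], rule ballI)
    fix t :: real assume "t \<in> {0..1}"
    show "continuous (at t within {0..1}) G"
    proof (cases "t = 0")
      case True
      \<comment> \<open>The power beats the logarithm, so \<open>G\<close> is continuous at 0 and
        the fundamental theorem needs its derivative only on the open interval.\<close>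
      have "(G \<longlongrightarrow> 0) (at_right 0)"
        unfolding G_def by real_asymp
      moreover have "at 0 within {0..1} = at_right (0::real)"
        by (simp add: at_within_Icc_at_right)
      ultimately show ?thesis
        using True by (simp add: continuous_within G_def)
    next
      case False
      then show ?thesis
        unfolding G_def by (intro continuous_intros) auto
    qed
  qed
  moreover have "(G has_vector_derivative t ^ n * ln (1 / t)) (at t)" if "t \<in> {0<..<1}" for t
  proof -
    have "(G has_real_derivative ((n + 1) * t ^ n * (1 - (n + 1) * ln t)
        + t ^ (n + 1) * (- ((n + 1) * (1 / t)))) / (real n + 1)\<^sup>2) (at t)"
    proof -
      have "((\<lambda>t. t ^ (n + 1)) has_real_derivative (n + 1) * t ^ n) (at t)"
        using DERIV_pow[of "n + 1" t] by simp
      moreover have "((\<lambda>t. 1 - (n + 1) * ln t) has_real_derivative - ((n + 1) * (1 / t))) (at t)"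
        using that by (auto intro!: derivative_eq_intros)
      ultimately show ?thesis
        unfolding G_def by (intro DERIV_cdivide) (use DERIV_mult' in \<open>force simp: add.commute\<close>)
    qed
    also have "((n + 1) * t ^ n * (1 - (n + 1) * ln t) + t ^ (n + 1) * (- ((n + 1) * (1 / t))))
        = (real n + 1)\<^sup>2 * (t ^ n * ln (1 / t))"
      using that by (simp add: ln_div power2_eq_square algebra_simps)
    finally show ?thesis
      by (simp add: has_real_derivative_iff_has_vector_derivative)
  qed
  ultimately have "((\<lambda>t. t ^ n * ln (1 / t)) has_integral (G 1 - G 0)) {0..1}"
    by (intro fundamental_theorem_of_calculus_interior) auto
  then have "((\<lambda>t. t ^ n * ln (1 / t)) has_integral (1 / (real n + 1)\<^sup>2)) {0..1}"
    by (simp add: G_def)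
  then show ?thesis
    by (intro nn_integral_has_integral_lebesgue')
      (auto simp: ln_div mult_nonneg_nonpos intro!: mult_nonneg_nonneg)
qed

subsection \<open>The weighted area measure of the disc\<close>

text \<open>With the weight and the normalization \<open>1/pi\<close> absorbed into the measure, the
  integral in the H^2 norm is the squared L^2 norm of \<open>f'\<close>. The base space is the disc
  itself because nothing is known about \<open>deriv f\<close> outside it.\<close>

definition disc_measure :: "complex measure" where
  "disc_measure = density (restrict_space lborel (ball 0 1)) (\<lambda>w. ennreal (H2_weight w / pi))"

lemma space_disc_measure [simp]: "space disc_measure = ball 0 1"
  by (simp add: disc_measure_def space_restrict_space)

lemma sets_disc_measure [measurable_cong]: "sets disc_measure = sets (restrict_space borel (ball 0 1))"
  by (simp add: disc_measure_def sets_restrict_space)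

lemma borel_measurable_disc_measure_continuous:
  assumes "continuous_on (ball 0 1) f"
  shows "f \<in> borel_measurable disc_measure"
  using borel_measurable_continuous_on_restrict[OF assms]
  by (simp add: measurable_cong_sets[OF sets_disc_measure refl])

lemma H2_weight_measurable [measurable]: "H2_weight \<in> borel_measurable borel"
  unfolding H2_weight_def [abs_def] by measurable

lemma H2_weight_nonneg: "w \<in> ball 0 1 \<Longrightarrow> 0 \<le> H2_weight w"
  \<comment> \<open>At the origin, division by zero replaces the infinite weight by the default
    value \<open>ln 0\<close>; a single point carries no area.\<close>
  by (cases "w = 0") (auto simp: H2_weight_def abs_square_le_1 power_le_one)

lemma H2_weight_mult: "cmod l = 1 \<Longrightarrow> H2_weight (l * w) = H2_weight w"
  by (simp add: H2_weight_def norm_mult)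

lemma nn_integral_disc_measure:
  assumes f: "f \<in> borel_measurable disc_measure"
  shows "(\<integral>\<^sup>+w. f w \<partial>disc_measure)
    = (\<integral>\<^sup>+w. ennreal (H2_weight w / pi) * f w * indicator (ball 0 1) w \<partial>lborel)"
proof -
  have f': "f \<in> borel_measurable (restrict_space lborel (ball 0 1))"
    using f by (simp add: disc_measure_def)
  show ?thesis
    unfolding disc_measure_def
    by (subst nn_integral_density) (use f' in \<open>auto simp: nn_integral_restrict_space
        intro!: measurable_restrict_space1\<close>)
qed

lemma
  fixes f :: "complex \<Rightarrow> 'a::{banach, second_countable_topology}"
  assumes f: "f \<in> borel_measurable disc_measure"
  shows integrable_disc_measure_iff: "integrable disc_measure f
      \<longleftrightarrow> set_integrable lborel (ball 0 1) (\<lambda>w. H2_weight w *\<^sub>R f w)"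
    and integral_disc_measure:
      "integral\<^sup>L disc_measure f = (LINT w:ball 0 1|lborel. H2_weight w *\<^sub>R f w) /\<^sub>R pi"
proof -
  have f': "f \<in> borel_measurable (restrict_space lborel (ball 0 1))"
    using f by (simp add: disc_measure_def)
  have W: "(\<lambda>w. H2_weight w / pi) \<in> borel_measurable (restrict_space lborel (ball 0 1))"
    by (intro measurable_restrict_space1) simp
  have nn: "AE w in restrict_space lborel (ball 0 1). 0 \<le> H2_weight w / pi"
    by (auto simp: AE_restrict_space_iff H2_weight_nonneg)
  have ball: "ball 0 1 \<inter> space lborel \<in> sets (lborel :: complex measure)"
    by simp
  have eq: "indicator (ball 0 1) w *\<^sub>R (H2_weight w / pi) *\<^sub>R f w
      = (1 / pi) *\<^sub>R (indicator (ball 0 1) w *\<^sub>R H2_weight w *\<^sub>R f w)" for w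
    by (simp add: mult_ac)
  show "integrable disc_measure f
      \<longleftrightarrow> set_integrable lborel (ball 0 1) (\<lambda>w. H2_weight w *\<^sub>R f w)"
  proof
    assume "integrable disc_measure f"
    then have "integrable lborel (\<lambda>w. pi *\<^sub>R (indicator (ball 0 1) w *\<^sub>R (H2_weight w / pi) *\<^sub>R f w))"
      unfolding disc_measure_def integrable_density[OF f' W nn] integrable_restrict_space[OF ball]
      by (rule integrable_scaleR_right)
    then show "set_integrable lborel (ball 0 1) (\<lambda>w. H2_weight w *\<^sub>R f w)"
      by (simp add: set_integrable_def mult_ac)
  next
    assume "set_integrable lborel (ball 0 1) (\<lambda>w. H2_weight w *\<^sub>R f w)"
    then show "integrable disc_measure f"
      unfolding disc_measure_def integrable_density[OF f' W nn] integrable_restrict_space[OF ball]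
      unfolding eq set_integrable_def by (rule integrable_scaleR_right)
  qed
  show "integral\<^sup>L disc_measure f = (LINT w:ball 0 1|lborel. H2_weight w *\<^sub>R f w) /\<^sub>R pi"
    unfolding disc_measure_def integral_density[OF f' W nn]
    unfolding integral_restrict_space[OF ball]
    by (simp add: eq set_lebesgue_integral_def inverse_eq_divide del: scaleR_scaleR)
qed

lemma measurable_mult_disc_measure:
  assumes "cmod l = 1"
  shows "(*) l \<in> disc_measure \<rightarrow>\<^sub>M disc_measure"
proof -
  have "(*) l \<in> restrict_space borel (ball 0 1) \<rightarrow>\<^sub>M restrict_space borel (ball 0 1)"
    using assms by (intro measurable_restrict_space3) (auto simp: norm_mult)
  then show ?thesis
    by (simp add: measurable_cong_sets[OF sets_disc_measure sets_disc_measure])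
qed

lemma nn_integral_disc_measure_mult:
  assumes f: "f \<in> borel_measurable disc_measure" and l: "cmod l = 1"
  shows "(\<integral>\<^sup>+w. f (l * w) \<partial>disc_measure) = (\<integral>\<^sup>+w. f w \<partial>disc_measure)"
proof -
  \<comment> \<open>\<open>f\<close> is measurable only on the disc, so it is extended by zero
    before the rotation invariance of the whole plane is applied.\<close>
  define F where "F = (\<lambda>w. ennreal (H2_weight w / pi) * f w * indicator (ball 0 1) w)"
  have "(\<lambda>w. f w * indicator (ball 0 1) w) \<in> borel_measurable borel"
    using f borel_measurable_restrict_space_iff_ennreal[of "ball 0 1" borel f]
    by (simp add: measurable_cong_sets[OF sets_disc_measure refl])
  then have [measurable]: "(\<lambda>w. f w * indicator (ball 0 1) w) \<in> borel_measurable borel" .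
  have F [measurable]: "F \<in> borel_measurable borel"
    unfolding F_def mult.assoc by (rule borel_measurable_times_ennreal) measurable
  have "(\<integral>\<^sup>+w. f w \<partial>disc_measure) = (\<integral>\<^sup>+w. F w \<partial>lborel)"
    unfolding F_def by (rule nn_integral_disc_measure[OF f])
  also have "\<dots> = (\<integral>\<^sup>+w. F w \<partial>distr lborel borel ((*) l))"
    by (simp add: lborel_distr_orthogonal_transformation orthogonal_transformation_complex_mult l)
  also have "\<dots> = (\<integral>\<^sup>+w. F (l * w) \<partial>lborel)"
    by (subst nn_integral_distr) auto
  also have "\<dots> = (\<integral>\<^sup>+w. ennreal (H2_weight w / pi) * f (l * w) * indicator (ball 0 1) w \<partial>lborel)"
    using l by (intro nn_integral_cong) (simp add: F_def H2_weight_mult indicator_def norm_mult)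
  also have "\<dots> = (\<integral>\<^sup>+w. f (l * w) \<partial>disc_measure)"
    using measurable_compose[OF measurable_mult_disc_measure[OF l] f]
    by (rule nn_integral_disc_measure[symmetric])
  finally show ?thesis ..
qed

text \<open>Under \<open>t = |w|^2\<close> the mass \<open>pi\<close> of the image measure cancels
  the normalization, leaving the integral of \<open>t^n ln (1/t)\<close> over [0,1].\<close>

lemma nn_integral_disc_measure_power:
  "(\<integral>\<^sup>+w. ennreal (cmod w ^ (2 * n)) \<partial>disc_measure) = ennreal (1 / (real n + 1)\<^sup>2)"
proof -
  define q where "q = (\<lambda>t::real. ennreal (t ^ n * ln (1 / t) / pi))"
  have [measurable]: "q \<in> borel_measurable borel"
    unfolding q_def by measurable
  have "(\<integral>\<^sup>+w. ennreal (cmod w ^ (2 * n)) \<partial>disc_measure)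
     = (\<integral>\<^sup>+w. ennreal (H2_weight w / pi) * ennreal (cmod w ^ (2 * n)) * indicator (ball 0 1) w \<partial>lborel)"
    by (intro nn_integral_disc_measure borel_measurable_disc_measure_continuous[THEN measurable_compose] 
      measurable_ennreal) (intro continuous_intros)
  also have "\<dots> = (\<integral>\<^sup>+w. q ((cmod w)\<^sup>2) * indicator (ball 0 1) w \<partial>lborel)"
    by (intro nn_integral_cong)
      (simp add: q_def H2_weight_def power_mult[of _ 2 n] H2_weight_nonneg[unfolded H2_weight_def]
        split: split_indicator flip: ennreal_mult'')
  also have "\<dots> = (\<integral>\<^sup>+w. q ((cmod w)\<^sup>2) \<partial>restrict_space lborel (ball 0 1))"
    by (simp add: nn_integral_restrict_space)
  also have "\<dots> = (\<integral>\<^sup>+t. q t \<partial>distr (restrict_space lborel (ball 0 1)) borel (\<lambda>w::complex. (cmod w)\<^sup>2))"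
    by (subst nn_integral_distr) (auto intro: measurable_restrict_space1)
  also have "\<dots> = (\<integral>\<^sup>+t\<in>{0..1}. ennreal (t ^ n * ln (1 / t)) \<partial>lborel)"
    unfolding distr_cmod_square_ball
    by (subst nn_integral_density)
      (auto intro!: nn_integral_cong simp: q_def split: split_indicator simp flip: ennreal_mult')
  finally show ?thesis
    by (simp add: nn_integral_power_ln)
qed

subsection \<open>Circle means of power series\<close>

lemma finite_measure_disc_measure: "finite_measure disc_measure"
proof (rule finite_measureI)
  show "emeasure disc_measure (space disc_measure) \<noteq> \<infinity>"
    using nn_integral_disc_measure_power[of 0] by simp
qed

lemma summable_norm_power_series_disc:
  fixes d :: "nat \<Rightarrow> complex"
  assumes "\<And>w. w \<in> ball 0 1 \<Longrightarrow> (\<lambda>n. d n * w ^ n) sums F w" and w: "w \<in> ball 0 1"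
  shows "summable (\<lambda>n. cmod (d n * w ^ n))"
proof -
  \<comment> \<open>A point of the disc strictly beyond \<open>w\<close> in modulus: convergence
    there forces absolute convergence at \<open>w\<close>.\<close>
  define s where "s = (cmod w + 1) / 2"
  have "summable (\<lambda>n. d n * of_real s ^ n)" "cmod w < cmod (complex_of_real s)"
    using assms(1)[of "of_real s"] w by (auto simp: s_def sums_iff)
  then show ?thesis
    using powser_insidea by blast
qed

section \<open>Orthogonality and Parseval's identity on the circle (total mass
  \<open>2 * pi\<close>)\<close>

definition circle_measure :: "real measure" where
  "circle_measure = restrict_space lborel {0..2 * pi}"

lemma finite_measure_circle_measure: "finite_measure circle_measure"
  by (rule finite_measureI) (simp add: circle_measure_def emeasure_restrict_space space_restrict_space)

lemma emeasure_circle_measure: "emeasure circle_measure (space circle_measure) = ennreal (2 * pi)"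
  by (simp add: circle_measure_def emeasure_restrict_space space_restrict_space)

lemma measure_circle_measure: "measure circle_measure (space circle_measure) = 2 * pi"
  by (simp add: measure_def emeasure_circle_measure)

lemma measurable_circle_measureI: "f \<in> borel_measurable borel \<Longrightarrow> f \<in> borel_measurable circle_measure"
  unfolding circle_measure_def by (rule measurable_restrict_space1) simp

lemma integrable_circle_measure_bounded:
  fixes f :: "real \<Rightarrow> 'a::{banach, second_countable_topology}"
  assumes "f \<in> borel_measurable borel" "\<And>x. norm (f x) \<le> B"
  shows "integrable circle_measure f"
  using assms
  by (intro finite_measure.integrable_const_bound[OF finite_measure_circle_measure, of f B]
    measurable_circle_measureI) auto

lemma integral_circle_measure_cis:
  "integral\<^sup>L circle_measure (\<lambda>\<theta>. cis (of_int k * \<theta>)) = (if k = 0 then 2 * of_real pi else 0)"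
proof (cases "k = 0")
  case True
  then show ?thesis
    by (simp add: measure_circle_measure scaleR_conv_of_real)
next
  case False
  have der: "((\<lambda>\<theta>. - \<i> / of_int k * cis (of_int k * \<theta>)) has_vector_derivative cis (of_int k * x))
      (at x within {0..2 * pi})" for x
  proof -
    have "((\<lambda>z. - \<i> / of_int k * exp (\<i> * of_int k * z)) has_field_derivative exp (\<i> * of_int k * of_real x))
        (at (of_real x))"
      using False by (auto intro!: derivative_eq_intros)
    from has_vector_derivative_real_field[OF this] show ?thesis
      by (simp add: cis_conv_exp mult.assoc)
  qed
  have "integral\<^sup>L circle_measure (\<lambda>\<theta>. cis (of_int k * \<theta>))
      = - \<i> / of_int k * cis (of_int k * (2 * pi)) - - \<i> / of_int k * cis (of_int k * 0)"
    unfolding circle_measure_def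
    by (subst integral_restrict_space, simp, rule integral_FTC_Icc)
      (auto intro!: der[simplified] continuous_intros)
  also have "cis (of_int k * (2 * pi)) = 1"
    by (metis cis_multiple_2pi Ints_of_int mult.commute)
  finally show ?thesis
    using False by simp
qed

lemma integral_circle_measure_series:
  fixes c :: "nat \<Rightarrow> complex"
  assumes c: "summable (\<lambda>n. cmod (c n))"
  shows "integral\<^sup>L circle_measure (\<lambda>\<theta>. (\<Sum>n. c n * cis (real n * \<theta>)) * cis (- (of_int k * \<theta>)))
    = (if k \<ge> 0 then 2 * of_real pi * c (nat k) else 0)"
proof -
  define f where "f = (\<lambda>n \<theta>. c n * cis (of_int (int n - k) * \<theta>))"
  have int: "integrable circle_measure (f n)" for n
    unfolding f_def by (intro integrable_circle_measure_bounded[where B = "cmod (c n)"])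
      (auto simp: norm_mult intro!: borel_measurable_continuous_onI continuous_intros)
  have sm: "summable (\<lambda>n. f n \<theta>)" for \<theta>
    by (rule summable_norm_cancel) (simp add: f_def norm_mult c)
  have "(\<lambda>n. integral\<^sup>L circle_measure (f n)) sums (\<integral>\<theta>. (\<Sum>n. f n \<theta>) \<partial>circle_measure)"
    by (rule sums_integral[OF int])
      (use summable_mult2[OF c, of "2 * pi"] in \<open>simp_all add: f_def norm_mult c measure_circle_measure mult_ac\<close>)
  moreover have "(\<lambda>n. integral\<^sup>L circle_measure (f n)) sums (if k \<ge> 0 then 2 * of_real pi * c (nat k) else 0)"
  proof -
    have "integral\<^sup>L circle_measure (f n) = (if int n = k then 2 * of_real pi * c n else 0)" for n
      unfolding f_def by (subst integral_mult_right_zero, subst integral_circle_measure_cis) auto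
    moreover have "(\<lambda>n. if int n = k then 2 * of_real pi * c n else 0)
        sums (if k \<ge> 0 then 2 * of_real pi * c (nat k) else 0)"
    proof (cases "k \<ge> 0")
      case True
      then have "int n = k \<longleftrightarrow> n = nat k" for n by auto
      then show ?thesis
        using True sums_single[of "nat k" "\<lambda>n. 2 * of_real pi * c n"] by simp
    qed auto
    ultimately show ?thesis by simp
  qed
  moreover have "(\<Sum>n. f n \<theta>) = (\<Sum>n. c n * cis (real n * \<theta>)) * cis (- (of_int k * \<theta>))" for \<theta>
  proof -
    have "f n \<theta> = c n * cis (real n * \<theta>) * cis (- (of_int k * \<theta>))" for n
      by (simp add: f_def cis_mult algebra_simps)
    moreover have "summable (\<lambda>n. c n * cis (real n * \<theta>))"
      by (rule summable_norm_cancel) (simp add: norm_mult c)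
    ultimately show ?thesis
      by (simp add: suminf_mult2)
  qed
  ultimately show ?thesis
    using sums_unique2 by fastforce
qed

text \<open>Only the factor \<open>cnj (G \<theta>)\<close> of the squared modulus is expanded; each
  term then integrates \<open>G\<close> against one exponential and returns one coefficient. No
  double series arises.\<close>

lemma parseval_circle_measure:
  fixes c :: "nat \<Rightarrow> complex"
  assumes c: "summable (\<lambda>n. cmod (c n))"
  defines "G \<equiv> \<lambda>\<theta>. \<Sum>n. c n * cis (real n * \<theta>)"
  shows "(\<integral>\<^sup>+\<theta>. ennreal ((cmod (G \<theta>))\<^sup>2) \<partial>circle_measure) = (\<Sum>n. ennreal (2 * pi * (cmod (c n))\<^sup>2))"
proof -
  define S where "S = (\<Sum>n. cmod (c n))"
  define f where "f = (\<lambda>n \<theta>. cnj (c n) * (G \<theta> * cis (- (of_int (int n) * \<theta>))))"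
  have sm: "summable (\<lambda>n. c n * cis (real n * \<theta>))" for \<theta>
    by (rule summable_norm_cancel) (simp add: norm_mult c)
  have G_bound: "cmod (G \<theta>) \<le> S" for \<theta>
    unfolding G_def S_def
    by (rule order.trans[OF summable_norm]) (simp_all add: norm_mult c)
  have "S \<ge> 0" using G_bound[of 0] norm_ge_zero order.trans by blast
  have cis [measurable]: "cis \<in> borel_measurable borel"
    by (intro borel_measurable_continuous_onI continuous_intros)
  have G [measurable]: "G \<in> borel_measurable borel"
    unfolding G_def by measurable
  have f_bound: "cmod (f n \<theta>) \<le> cmod (c n) * S" for n \<theta>
    by (simp add: f_def norm_mult G_bound mult_left_mono)
  have int: "integrable circle_measure (f n)" for n
    by (rule integrable_circle_measure_bounded[OF _ f_bound]) (simp add: f_def)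
  have fs: "(\<lambda>n. f n \<theta>) sums of_real ((cmod (G \<theta>))\<^sup>2)" for \<theta>
  proof -
    have "(\<lambda>n. G \<theta> * cnj (c n * cis (real n * \<theta>))) sums (G \<theta> * cnj (G \<theta>))"
      using sm[of \<theta>] unfolding G_def by (intro sums_mult sums_cnj[THEN iffD2] summable_sums)
    then show ?thesis
      by (simp add: f_def cis_cnj mult_ac flip: complex_norm_square)
  qed
  have "(\<lambda>n. integral\<^sup>L circle_measure (f n)) sums (\<integral>\<theta>. (\<Sum>n. f n \<theta>) \<partial>circle_measure)"
  proof (rule sums_integral[OF int])
    have sb: "summable (\<lambda>n. cmod (c n) * S)"
      using c by (rule summable_mult2)
    show "AE \<theta> in circle_measure. summable (\<lambda>n. cmod (f n \<theta>))"
      using f_bound by (intro AE_I2 summable_comparison_test'[OF sb]) auto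
    show "summable (\<lambda>n. LINT \<theta>|circle_measure. cmod (f n \<theta>))"
    proof (rule summable_comparison_test'[OF summable_mult2[OF sb, of "2 * pi"]])
      fix n
      have "(LINT \<theta>|circle_measure. cmod (f n \<theta>)) \<le> (LINT \<theta>|circle_measure. cmod (c n) * S)"
        by (intro integral_mono integrable_norm int f_bound finite_measure.integrable_const
          finite_measure_circle_measure)
      then show "norm (LINT \<theta>|circle_measure. cmod (f n \<theta>)) \<le> cmod (c n) * S * (2 * pi)"
        by (simp add: measure_circle_measure mult_ac)
    qed
  qed
  moreover have "integral\<^sup>L circle_measure (f n) = of_real (2 * pi * (cmod (c n))\<^sup>2)" for n
  proof -
    have "integral\<^sup>L circle_measure (f n) = cnj (c n) * (2 * of_real pi * c n)"
      unfolding f_def G_def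
      by (subst integral_mult_right_zero, subst integral_circle_measure_series[OF c]) simp
    also have "\<dots> = of_real (2 * pi * (cmod (c n))\<^sup>2)"
      using complex_norm_square[of "c n"] by (simp add: mult_ac)
    finally show ?thesis .
  qed
  moreover have "(\<integral>\<theta>. (\<Sum>n. f n \<theta>) \<partial>circle_measure)
      = of_real (\<integral>\<theta>. (cmod (G \<theta>))\<^sup>2 \<partial>circle_measure)"
    by (simp add: sums_unique[OF fs, symmetric] del: of_real_power)
  ultimately have s: "(\<lambda>n. 2 * pi * (cmod (c n))\<^sup>2) sums (\<integral>\<theta>. (cmod (G \<theta>))\<^sup>2 \<partial>circle_measure)"
    by (simp add: sums_of_real_iff del: of_real_mult of_real_power)
  have "integrable circle_measure (\<lambda>\<theta>. (cmod (G \<theta>))\<^sup>2)"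
    using G_bound by (intro integrable_circle_measure_bounded[where B = "S\<^sup>2"]) (auto intro!: power_mono)
  then have "(\<integral>\<^sup>+\<theta>. ennreal ((cmod (G \<theta>))\<^sup>2) \<partial>circle_measure)
      = ennreal (\<integral>\<theta>. (cmod (G \<theta>))\<^sup>2 \<partial>circle_measure)"
    by (intro nn_integral_eq_integral) auto
  also have "\<dots> = (\<Sum>n. ennreal (2 * pi * (cmod (c n))\<^sup>2))"
    using s by (subst suminf_ennreal2) (auto simp: sums_iff)
  finally show ?thesis .
qed

text \<open>All rotates of \<open>F\<close> have the same integral, so averaging over the angle
  costs only the factor \<open>2 * pi\<close>; at fixed \<open>w\<close> the average is Parseval for
  the coefficients \<open>d n * w ^ n\<close>. Working with extended nonnegative integrals allows
  both sides to be infinite, so the identity also decides integrability.\<close>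

lemma nn_integral_disc_measure_power_series:
  assumes F: "\<And>w. w \<in> ball 0 1 \<Longrightarrow> (\<lambda>n. d n * w ^ n) sums F w"
  shows "(\<integral>\<^sup>+w. ennreal ((cmod (F w))\<^sup>2) \<partial>disc_measure) = (\<Sum>n. ennreal ((cmod (d n))\<^sup>2 / (real n + 1)\<^sup>2))"
    (is "?I = _")
proof -
  interpret D: finite_measure disc_measure by (rule finite_measure_disc_measure)
  interpret C: finite_measure circle_measure by (rule finite_measure_circle_measure)
  interpret P: pair_sigma_finite circle_measure disc_measure ..
  have "F holomorphic_on ball 0 1"
    by (rule power_series_holomorphic[of _ _ d]) (simp add: F)
  then have F_meas [measurable]: "F \<in> borel_measurable disc_measure"
    by (intro borel_measurable_disc_measure_continuous holomorphic_on_imp_continuous_on)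
  \<comment> \<open>Joint measurability of the rotation in angle and point is what Tonelli
    requires.\<close>
  have rot: "(\<lambda>x. cis (fst x) * snd x) \<in> circle_measure \<Otimes>\<^sub>M disc_measure \<rightarrow>\<^sub>M disc_measure"
  proof -
    have "(\<lambda>x. cis (fst x) * snd x) \<in> circle_measure \<Otimes>\<^sub>M disc_measure \<rightarrow>\<^sub>M restrict_space borel (ball 0 1)"
    proof (rule measurable_restrict_space2)
      have 1: "cis \<in> borel_measurable circle_measure"
        by (intro measurable_circle_measureI borel_measurable_continuous_onI continuous_intros)
      have 2: "(\<lambda>w. w) \<in> borel_measurable disc_measure"
        by (intro borel_measurable_disc_measure_continuous continuous_intros)
      show "(\<lambda>x. cis (fst x) * snd x) \<in> borel_measurable (circle_measure \<Otimes>\<^sub>M disc_measure)"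
        by (intro borel_measurable_times measurable_compose[OF measurable_fst 1]
          measurable_compose[OF measurable_snd 2])
    qed (auto simp: space_pair_measure norm_mult)
    then show ?thesis
      by (simp add: measurable_cong_sets[OF refl sets_disc_measure])
  qed
  have "ennreal (2 * pi) * ?I
      = (\<integral>\<^sup>+\<theta>. \<integral>\<^sup>+w. ennreal ((cmod (F (cis \<theta> * w)))\<^sup>2) \<partial>disc_measure \<partial>circle_measure)"
    by (subst nn_integral_disc_measure_mult[of "\<lambda>w. ennreal ((cmod (F w))\<^sup>2)"])
      (simp_all add: emeasure_circle_measure mult.commute)
  also have "\<dots> = (\<integral>\<^sup>+w. \<integral>\<^sup>+\<theta>. ennreal ((cmod (F (cis \<theta> * w)))\<^sup>2) \<partial>circle_measure \<partial>disc_measure)"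
    using measurable_compose[OF rot F_meas]
    by (intro P.Fubini'[symmetric]) (simp add: case_prod_unfold)
  also have "\<dots> = (\<integral>\<^sup>+w. (\<Sum>n. ennreal (2 * pi * (cmod (d n))\<^sup>2) * ennreal (cmod w ^ (2 * n))) \<partial>disc_measure)"
  proof (rule nn_integral_cong)
    fix w assume "w \<in> space disc_measure"
    then have w: "w \<in> ball 0 1" by simp
    have "F (cis \<theta> * w) = (\<Sum>n. (d n * w ^ n) * cis (real n * \<theta>))" for \<theta>
    proof -
      have "(\<lambda>n. d n * (cis \<theta> * w) ^ n) sums F (cis \<theta> * w)"
        using w by (intro F) (simp add: norm_mult)
      moreover have "d n * (cis \<theta> * w) ^ n = d n * w ^ n * cis (real n * \<theta>)" for n
        by (simp add: power_mult_distrib Complex.DeMoivre)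
      ultimately show ?thesis
        by (simp add: sums_iff)
    qed
    then have "(\<integral>\<^sup>+\<theta>. ennreal ((cmod (F (cis \<theta> * w)))\<^sup>2) \<partial>circle_measure)
        = (\<Sum>n. ennreal (2 * pi * (cmod (d n * w ^ n))\<^sup>2))"
      by (simp only: parseval_circle_measure[OF summable_norm_power_series_disc[OF F w]])
    also have "\<dots> = (\<Sum>n. ennreal (2 * pi * (cmod (d n))\<^sup>2) * ennreal (cmod w ^ (2 * n)))"
    proof -
      have "2 * pi * (cmod (d n * w ^ n))\<^sup>2 = 2 * pi * (cmod (d n))\<^sup>2 * cmod w ^ (2 * n)" for n
        by (simp add: norm_mult norm_power power_mult_distrib mult.commute[of 2 n] power_mult)
      then have "ennreal (2 * pi * (cmod (d n * w ^ n))\<^sup>2)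
          = ennreal (2 * pi * (cmod (d n))\<^sup>2) * ennreal (cmod w ^ (2 * n))" for n
        by (metis ennreal_mult'' zero_le_power norm_ge_zero)
      then show ?thesis by simp
    qed
    finally show "(\<integral>\<^sup>+\<theta>. ennreal ((cmod (F (cis \<theta> * w)))\<^sup>2) \<partial>circle_measure)
        = (\<Sum>n. ennreal (2 * pi * (cmod (d n))\<^sup>2) * ennreal (cmod w ^ (2 * n)))" .
  qed
  also have "\<dots> = (\<Sum>n. ennreal (2 * pi * (cmod (d n))\<^sup>2) * ennreal (1 / (real n + 1)\<^sup>2))"
  proof -
    have "(\<lambda>w. ennreal (cmod w ^ (2 * n))) \<in> borel_measurable disc_measure" for n
      by (intro borel_measurable_disc_measure_continuous[THEN measurable_compose] measurable_ennreal)
        (intro continuous_intros)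
    then show ?thesis
      by (subst nn_integral_suminf) (simp_all add: nn_integral_cmult nn_integral_disc_measure_power)
  qed
  also have "\<dots> = ennreal (2 * pi) * (\<Sum>n. ennreal ((cmod (d n))\<^sup>2 / (real n + 1)\<^sup>2))"
  proof -
    have "ennreal (2 * pi * (cmod (d n))\<^sup>2) * ennreal (1 / (real n + 1)\<^sup>2)
        = ennreal (2 * pi) * ennreal ((cmod (d n))\<^sup>2 / (real n + 1)\<^sup>2)" for n
      by (subst (1 2) ennreal_mult[symmetric]) auto
    then show ?thesis
      by simp
  qed
  finally show ?thesis
    by (subst (asm) ennreal_mult_cancel_left) auto
qed

subsection \<open>Taylor coefficients and the Hardy norm\<close>

lemma
  assumes F: "\<And>w. w \<in> ball 0 1 \<Longrightarrow> (\<lambda>n. d n * w ^ n) sums F w"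
  shows integrable_norm_square_power_series: "integrable disc_measure (\<lambda>w. (cmod (F w))\<^sup>2)
      \<longleftrightarrow> summable (\<lambda>n. (cmod (d n))\<^sup>2 / (real n + 1)\<^sup>2)" (is "?I \<longleftrightarrow> ?S")
    and integral_norm_square_power_series: "integrable disc_measure (\<lambda>w. (cmod (F w))\<^sup>2) \<Longrightarrow>
      (\<lambda>n. (cmod (d n))\<^sup>2 / (real n + 1)\<^sup>2) sums (\<integral>w. (cmod (F w))\<^sup>2 \<partial>disc_measure)"
proof -
  have nn: "(\<integral>\<^sup>+w. ennreal ((cmod (F w))\<^sup>2) \<partial>disc_measure) = (\<Sum>n. ennreal ((cmod (d n))\<^sup>2 / (real n + 1)\<^sup>2))"
    by (rule nn_integral_disc_measure_power_series) (rule F)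
  have "F holomorphic_on ball 0 1"
    by (rule power_series_holomorphic[of _ _ d]) (simp add: F)
  then have [measurable]: "F \<in> borel_measurable disc_measure"
    by (intro borel_measurable_disc_measure_continuous holomorphic_on_imp_continuous_on)
  have IS: ?S if ?I
  proof -
    have "(\<integral>\<^sup>+w. ennreal ((cmod (F w))\<^sup>2) \<partial>disc_measure) \<noteq> top"
      using that by (simp add: integrable_iff_bounded)
    then show ?thesis
      by (intro summable_suminf_not_top) (auto simp: nn)
  qed
  have SI: "?I \<and> (\<Sum>n. (cmod (d n))\<^sup>2 / (real n + 1)\<^sup>2) = (\<integral>w. (cmod (F w))\<^sup>2 \<partial>disc_measure)" if ?S
  proof -
    have "(\<integral>\<^sup>+w. ennreal ((cmod (F w))\<^sup>2) \<partial>disc_measure)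
        = ennreal (\<Sum>n. (cmod (d n))\<^sup>2 / (real n + 1)\<^sup>2)"
      unfolding nn by (rule suminf_ennreal2) (use that in auto)
    then show ?thesis
      by (subst (asm) nn_integral_eq_integrable) (use that in \<open>auto intro!: suminf_nonneg\<close>)
  qed
  show "?I \<longleftrightarrow> ?S" using IS SI by blast
  show "(\<lambda>n. (cmod (d n))\<^sup>2 / (real n + 1)\<^sup>2) sums (\<integral>w. (cmod (F w))\<^sup>2 \<partial>disc_measure)" if ?I
    using IS[OF that] SI by (simp add: sums_iff)
qed

text \<open>The measure is finite, so square integrability implies integrability; the majorant comes
  from \<open>x \<le> x^2 + 1\<close>.\<close>

lemma integrable_disc_measure_of_norm_square:
  fixes F :: "complex \<Rightarrow> complex"
  assumes [measurable]: "F \<in> borel_measurable disc_measure"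
    and I: "integrable disc_measure (\<lambda>w. (cmod (F w))\<^sup>2)"
  shows "integrable disc_measure F"
proof (rule Bochner_Integration.integrable_bound)
  show "integrable disc_measure (\<lambda>w. (cmod (F w))\<^sup>2 + 1)"
    by (intro Bochner_Integration.integrable_add I finite_measure.integrable_const finite_measure_disc_measure)
  have "cmod (F w) \<le> (cmod (F w))\<^sup>2 + 1" for w
  proof -
    have "0 \<le> (cmod (F w) - 1 / 2)\<^sup>2" by simp
    then show ?thesis by (simp add: power2_eq_square algebra_simps)
  qed
  then show "AE w in disc_measure. norm (F w) \<le> norm ((cmod (F w))\<^sup>2 + 1)"
    by (simp add: add_nonneg_nonneg)
qed simp

lemma integrable_disc_measure_mult_bounded:
  fixes F :: "complex \<Rightarrow> complex"
  assumes F: "integrable disc_measure F" and G [measurable]: "G \<in> borel_measurable disc_measure"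
    and B: "\<And>w. w \<in> ball 0 1 \<Longrightarrow> cmod (G w) \<le> B"
  shows "integrable disc_measure (\<lambda>w. F w * G w)"
proof (rule Bochner_Integration.integrable_bound)
  show "integrable disc_measure (\<lambda>w. of_real B * F w)"
    using F by simp
  have [measurable]: "F \<in> borel_measurable disc_measure" using F by simp
  show "(\<lambda>w. F w * G w) \<in> borel_measurable disc_measure" by simp
  show "AE w in disc_measure. norm (F w * G w) \<le> norm (of_real B * F w)"
  proof (rule AE_I2)
    fix w assume "w \<in> space disc_measure"
    then have "cmod (G w) \<le> \<bar>B\<bar>" using B[of w] by simp
    then show "norm (F w * G w) \<le> norm (of_real B * F w)"
      using mult_left_mono[of "cmod (G w)" "\<bar>B\<bar>" "cmod (F w)"]
      by (simp add: norm_mult mult.commute)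
  qed
qed

text \<open>Polarization of the norm identity: perturb \<open>F\<close> by the monomials \<open>w\<^sup>n\<close> and \<open>\<i> w\<^sup>n\<close>.\<close>

lemma integral_power_series_mult_cnj_power:
  assumes F: "\<And>w. w \<in> ball 0 1 \<Longrightarrow> (\<lambda>n. d n * w ^ n) sums F w"
    and I: "integrable disc_measure (\<lambda>w. (cmod (F w))\<^sup>2)"
  shows "integrable disc_measure (\<lambda>w. F w * cnj w ^ n)"
    and "(\<integral>w. F w * cnj w ^ n \<partial>disc_measure) = d n / (of_nat n + 1)\<^sup>2"
proof -
  have "F holomorphic_on ball 0 1"
    by (rule power_series_holomorphic[of _ _ d]) (simp add: F)
  then have F_meas [measurable]: "F \<in> borel_measurable disc_measure"
    by (intro borel_measurable_disc_measure_continuous holomorphic_on_imp_continuous_on)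
  show int: "integrable disc_measure (\<lambda>w. F w * cnj w ^ n)"
    by (rule integrable_disc_measure_mult_bounded[where B = 1])
      (auto intro!: integrable_disc_measure_of_norm_square F_meas I power_le_one
        borel_measurable_disc_measure_continuous continuous_intros simp: norm_power)
  define J where "J = (\<integral>w. F w * cnj w ^ n \<partial>disc_measure)"
  define N where "N = (\<integral>w. (cmod (F w))\<^sup>2 \<partial>disc_measure)"
  have pow: "integrable disc_measure (\<lambda>w. cmod w ^ (2 * n))
      \<and> (\<integral>w. cmod w ^ (2 * n) \<partial>disc_measure) = 1 / (real n + 1)\<^sup>2"
    using nn_integral_disc_measure_power[of n]
    by (subst (asm) nn_integral_eq_integrable)
      (auto intro!: borel_measurable_disc_measure_continuous continuous_intros)
  \<comment> \<open>The norm of \<open>F + c w^n\<close> is computed pointwise and from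
    coefficients; only the cross term with \<open>J\<close> is unknown. The choice
    \<open>c = 1\<close> yields the real part of \<open>J\<close> and \<open>c = \<i>\<close> the
    imaginary part.\<close>
  have key: "Re (cnj c * J) = Re (cnj c * (d n / (of_nat n + 1)\<^sup>2))" if c: "cmod c = 1" for c
  proof -
    have G: "(\<lambda>m. (d m + (if m = n then c else 0)) * w ^ m) sums (F w + c * w ^ n)" if "w \<in> ball 0 1" for w
    proof -
      have "(d m + (if m = n then c else 0)) * w ^ m = d m * w ^ m + (if m = n then c * w ^ m else 0)" for m
        by (simp add: algebra_simps)
      then show ?thesis
        using sums_add[OF F[OF that] sums_single[of n "\<lambda>m. c * w ^ m"]] by simp
    qed
    have expand: "(cmod (F w + c * w ^ n))\<^sup>2
        = (cmod (F w))\<^sup>2 + cmod w ^ (2 * n) + 2 * Re (cnj c * (F w * cnj w ^ n))" for w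
    proof -
      have "(cmod (a + c * p))\<^sup>2 = (cmod a)\<^sup>2 + (cmod (c * p))\<^sup>2 + 2 * Re (cnj c * (a * cnj p))" for a p
        by (simp add: cmod_power2) (simp add: power2_eq_square algebra_simps)
      from this[of "F w" "w ^ n"] show ?thesis
        using c by (simp add: norm_mult norm_power power_mult mult.commute[of 2 n])
    qed
    have intc: "integrable disc_measure (\<lambda>w. cnj c * (F w * cnj w ^ n))"
      using int by simp
    have intG: "integrable disc_measure (\<lambda>w. (cmod (F w + c * w ^ n))\<^sup>2)"
      unfolding expand
      by (intro Bochner_Integration.integrable_add integrable_mult_right integrable_Re[OF intc] I conjunct1[OF pow])
    have "(\<integral>w. (cmod (F w + c * w ^ n))\<^sup>2 \<partial>disc_measure) = N + 1 / (real n + 1)\<^sup>2 + 2 * Re (cnj c * J)"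
    proof -
      have "(\<integral>w. 2 * Re (cnj c * (F w * cnj w ^ n)) \<partial>disc_measure) = 2 * Re (cnj c * J)"
        unfolding J_def by (simp only: integral_mult_right_zero integral_Re[OF intc])
      then show ?thesis
        unfolding expand N_def
        by (subst Bochner_Integration.integral_add Bochner_Integration.integral_add[where f = "\<lambda>w. (cmod (F w))\<^sup>2"],
            intro Bochner_Integration.integrable_add I conjunct1[OF pow],
            intro integrable_mult_right integrable_Re[OF intc])
          (simp only: conjunct2[OF pow] Bochner_Integration.integral_add[OF I conjunct1[OF pow]])
    qed
    \<comment> \<open>On the coefficient side the perturbation alters a single term of the norm
      series, the one of index \<open>n\<close>.\<close>
    moreover have "(\<integral>w. (cmod (F w + c * w ^ n))\<^sup>2 \<partial>disc_measure)
        = N + ((cmod (d n + c))\<^sup>2 - (cmod (d n))\<^sup>2) / (real n + 1)\<^sup>2"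
    proof (rule sums_unique2)
      show "(\<lambda>m. (cmod (d m + (if m = n then c else 0)))\<^sup>2 / (real m + 1)\<^sup>2)
          sums (\<integral>w. (cmod (F w + c * w ^ n))\<^sup>2 \<partial>disc_measure)"
        by (rule integral_norm_square_power_series[OF G intG])
      have "(\<lambda>m. (cmod (d m))\<^sup>2 / (real m + 1)\<^sup>2
          + (if m = n then ((cmod (d m + c))\<^sup>2 - (cmod (d m))\<^sup>2) / (real m + 1)\<^sup>2 else 0))
          sums (N + ((cmod (d n + c))\<^sup>2 - (cmod (d n))\<^sup>2) / (real n + 1)\<^sup>2)"
        unfolding N_def by (intro sums_add sums_single integral_norm_square_power_series[OF F I])
      then show "(\<lambda>m. (cmod (d m + (if m = n then c else 0)))\<^sup>2 / (real m + 1)\<^sup>2)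
          sums (N + ((cmod (d n + c))\<^sup>2 - (cmod (d n))\<^sup>2) / (real n + 1)\<^sup>2)"
        by (rule sums_cong[THEN iffD1, rotated]) (simp add: diff_divide_distrib)
    qed
    moreover have "(cmod (d n + c))\<^sup>2 - (cmod (d n))\<^sup>2 = 1 + 2 * Re (cnj c * d n)"
    proof -
      have "(cmod (d n + c))\<^sup>2 = (cmod (d n))\<^sup>2 + (cmod c)\<^sup>2 + 2 * Re (cnj c * d n)"
        by (simp add: cmod_power2) (simp add: power2_eq_square algebra_simps)
      then show ?thesis using c by simp
    qed
    ultimately have "Re (cnj c * J) = Re (cnj c * d n) / (real n + 1)\<^sup>2"
      by (simp add: add_divide_distrib)
    also have "\<dots> = Re (cnj c * d n / of_real ((real n + 1)\<^sup>2))"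
      by (rule Re_divide_of_real[symmetric])
    finally show ?thesis by simp
  qed
  show "(\<integral>w. F w * cnj w ^ n \<partial>disc_measure) = d n / (of_nat n + 1)\<^sup>2"
    using key[of 1] key[of \<i>] unfolding J_def by (simp add: complex_eq_iff)
qed

definition taylor_coeff :: "(complex \<Rightarrow> complex) \<Rightarrow> nat \<Rightarrow> complex" where
  "taylor_coeff f n = (deriv ^^ n) f 0 / fact n"

lemma taylor_coeff_sums:
  assumes "f holomorphic_on ball 0 1" "z \<in> ball 0 1"
  shows "(\<lambda>n. taylor_coeff f n * z ^ n) sums f z"
  using holomorphic_power_series[OF assms] by (simp add: taylor_coeff_def)

lemma taylor_coeff_0: "taylor_coeff f 0 = f 0"
  by (simp add: taylor_coeff_def)

text \<open>The bridge from pointwise series identities on the disc to coefficients, through which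
  operators are compared from here on.\<close>

lemma taylor_coeff_unique:
  assumes "\<And>z. z \<in> ball 0 1 \<Longrightarrow> (\<lambda>n. c n * z ^ n) sums f z"
  shows "taylor_coeff f = c"
proof
  fix n
  have "f has_fps_expansion Abs_fps c"
  proof (rule has_fps_expansionI)
    have "eventually (\<lambda>z. z \<in> ball 0 1) (nhds (0::complex))"
      by (intro eventually_nhds_in_open) auto
    then show "\<forall>\<^sub>F u in nhds 0. (\<lambda>n. fps_nth (Abs_fps c) n * u ^ n) sums f u"
      by eventually_elim (simp add: assms)
  qed
  from fps_nth_fps_expansion[OF this, of n] show "taylor_coeff f n = c n"
    by (simp add: taylor_coeff_def)
qed

lemma taylor_coeff_deriv: "taylor_coeff (deriv f) n = of_nat (Suc n) * taylor_coeff f (Suc n)"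
proof -
  have "(deriv ^^ n) (deriv f) = (deriv ^^ Suc n) f"
    by (simp add: funpow_Suc_right del: funpow.simps)
  then show ?thesis
    by (simp add: taylor_coeff_def fact_Suc del: funpow.simps of_nat_Suc)
qed

lemma deriv_taylor_sums:
  assumes "f holomorphic_on ball 0 1" "z \<in> ball 0 1"
  shows "(\<lambda>n. of_nat (Suc n) * taylor_coeff f (Suc n) * z ^ n) sums deriv f z"
  using taylor_coeff_sums[OF holomorphic_deriv[OF assms(1)] assms(2)]
  by (simp add: taylor_coeff_deriv)

text \<open>Differentiation multiplies by \<open>n+1\<close> exactly what the radial moment divides
  by.\<close>

lemma norm_square_deriv_coeff:
  "(cmod (of_nat (Suc n) * taylor_coeff f (Suc n)))\<^sup>2 / (real n + 1)\<^sup>2 = (cmod (taylor_coeff f (Suc n)))\<^sup>2"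
  by (simp add: norm_mult power_mult_distrib norm_of_nat add.commute del: of_nat_Suc)
    (simp add: add.commute)

lemma measurable_deriv_disc_measure:
  "f holomorphic_on ball 0 1 \<Longrightarrow> deriv f \<in> borel_measurable disc_measure"
  by (intro borel_measurable_disc_measure_continuous holomorphic_on_imp_continuous_on holomorphic_deriv) auto

lemma H2_integrable_iff:
  assumes f: "f holomorphic_on ball 0 1"
  shows "set_integrable lborel (ball 0 1) (\<lambda>w. (cmod (deriv f w))\<^sup>2 * H2_weight w)
     \<longleftrightarrow> integrable disc_measure (\<lambda>w. (cmod (deriv f w))\<^sup>2)"
  using measurable_deriv_disc_measure[OF f]
  by (subst integrable_disc_measure_iff) (simp_all add: mult.commute)

text \<open>Replaces the area integral in the definition by square summability. The derivative sees
  every coefficient except the constant one, and dropping one term does not affect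
  summability.\<close>

lemma H2_iff:
  "f \<in> H2 \<longleftrightarrow> f holomorphic_on ball 0 1 \<and> (\<forall>z. z \<notin> ball 0 1 \<longrightarrow> f z = 0)
     \<and> summable (\<lambda>n. (cmod (taylor_coeff f n))\<^sup>2)"
proof -
  have "integrable disc_measure (\<lambda>w. (cmod (deriv f w))\<^sup>2) \<longleftrightarrow> summable (\<lambda>n. (cmod (taylor_coeff f n))\<^sup>2)"
    if f: "f holomorphic_on ball 0 1"
    using integrable_norm_square_power_series[OF deriv_taylor_sums[OF f]]
    by (simp only: norm_square_deriv_coeff summable_Suc_iff[of "\<lambda>n. (cmod (taylor_coeff f n))\<^sup>2"])
  then show ?thesis
    unfolding H2_def by (auto simp: H2_integrable_iff)
qed

lemma H2_norm_sums:
  assumes f: "f \<in> H2"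
  shows "(\<lambda>n. (cmod (taylor_coeff f n))\<^sup>2) sums (H2_norm f)\<^sup>2"
proof -
  have hol: "f holomorphic_on ball 0 1" using f by (simp add: H2_def)
  have I: "integrable disc_measure (\<lambda>w. (cmod (deriv f w))\<^sup>2)"
    using f H2_integrable_iff[OF hol] by (simp add: H2_def)
  have "(\<lambda>n. (cmod (taylor_coeff f (Suc n)))\<^sup>2) sums (\<integral>w. (cmod (deriv f w))\<^sup>2 \<partial>disc_measure)"
    using integral_norm_square_power_series[OF deriv_taylor_sums[OF hol] I]
    unfolding norm_square_deriv_coeff .
  then have "(\<lambda>n. (cmod (taylor_coeff f n))\<^sup>2)
      sums ((\<integral>w. (cmod (deriv f w))\<^sup>2 \<partial>disc_measure) + (cmod (f 0))\<^sup>2)"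
    by (subst taylor_coeff_0[symmetric], rule sums_Suc)
  moreover have "(\<integral>w. (cmod (deriv f w))\<^sup>2 \<partial>disc_measure)
      = (LINT w:ball 0 1|lborel. (cmod (deriv f w))\<^sup>2 * H2_weight w) / pi"
    using measurable_deriv_disc_measure[OF hol]
    by (subst integral_disc_measure) (simp_all add: mult.commute divide_inverse)
  \<comment> \<open>Nonnegativity lets squaring undo the \<open>sqrt\<close> in
    \<open>H2_norm\<close>.\<close>
  moreover have "(\<integral>w. (cmod (deriv f w))\<^sup>2 \<partial>disc_measure) \<ge> 0"
    by simp
  ultimately show ?thesis
    by (simp add: H2_norm_def add.commute)
qed

subsection \<open>The integral operator\<close>

lemma H2_holomorphic: "f \<in> H2 \<Longrightarrow> f holomorphic_on ball 0 1"
  by (simp add: H2_def)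

lemma H2_outside: "f \<in> H2 \<Longrightarrow> z \<notin> ball 0 1 \<Longrightarrow> f z = 0"
  by (simp add: H2_def)

lemma H2_norm_nonneg: "f \<in> H2 \<Longrightarrow> 0 \<le> H2_norm f"
  unfolding H2_norm_def set_lebesgue_integral_def
  by (intro real_sqrt_ge_zero add_nonneg_nonneg divide_nonneg_nonneg integral_nonneg_AE AE_I2)
    (auto simp: indicator_def H2_weight_nonneg)

lemma H2_eqI:
  assumes "f \<in> H2" "g \<in> H2" "taylor_coeff f = taylor_coeff g"
  shows "f = g"
proof
  fix z
  show "f z = g z"
  proof (cases "z \<in> ball 0 1")
    case True
    then show ?thesis
      using taylor_coeff_sums[OF H2_holomorphic] assms sums_unique2 by metis
  qed (simp add: H2_outside assms)
qed

lemma norm_taylor_coeff_le_H2_norm: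
  assumes "f \<in> H2"
  shows "cmod (taylor_coeff f n) \<le> H2_norm f"
proof -
  have "(cmod (taylor_coeff f n))\<^sup>2 \<le> (H2_norm f)\<^sup>2"
    using sum_le_suminf[of "\<lambda>n. (cmod (taylor_coeff f n))\<^sup>2" "{n}"] H2_norm_sums[OF assms]
    by (simp add: sums_iff)
  then show ?thesis
    using H2_norm_nonneg[OF assms] power2_le_imp_le by blast
qed

text \<open>Expand \<open>deriv g (z * cnj w)\<close> in powers of \<open>cnj w\<close>. As
  \<open>z\<close> is interior, the coefficients \<open>b m\<close> are absolutely summable, and
  \<open>deriv f\<close> is integrable, so the series may be integrated termwise although
  \<open>g\<close> is only holomorphic. The outer factor \<open>z\<close> raises the degree by one,
  leaving degree 0 to the separate constant term.\<close>

lemma integral_formula_sums: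
  assumes f: "f \<in> H2" and g: "g holomorphic_on ball 0 1" and z: "z \<in> ball 0 1"
  shows "(\<lambda>m. taylor_coeff g m * taylor_coeff f m * z ^ m) sums
    (taylor_coeff g 0 * f 0 + z * (LINT w:ball 0 1|lborel. deriv f w * deriv g (z * cnj w) * of_real (H2_weight w))
      / of_real pi)"
proof -
  have hol: "f holomorphic_on ball 0 1" using f by (rule H2_holomorphic)
  have dmeas [measurable]: "deriv f \<in> borel_measurable disc_measure"
    by (rule measurable_deriv_disc_measure[OF hol])
  have I: "integrable disc_measure (\<lambda>w. (cmod (deriv f w))\<^sup>2)"
    using f H2_integrable_iff[OF hol] by (simp add: H2_def)
  have I1: "integrable disc_measure (deriv f)"
    by (rule integrable_disc_measure_of_norm_square[OF dmeas I])
  have zw: "z * cnj w \<in> ball 0 1" if "w \<in> ball 0 1" for w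
  proof -
    have "cmod z * cmod w \<le> cmod z * 1"
      using that by (intro mult_left_mono) auto
    then show ?thesis using z by (simp add: norm_mult)
  qed
  define b where "b = (\<lambda>m. of_nat (Suc m) * taylor_coeff g (Suc m) * z ^ m)"
  define h where "h = (\<lambda>m w. b m * (deriv f w * cnj w ^ m))"
  have b_sum: "summable (\<lambda>m. cmod (b m))"
    unfolding b_def by (rule summable_norm_power_series_disc[OF deriv_taylor_sums[OF g] z])
  have h_bound: "cmod (h m w) \<le> cmod (b m) * cmod (deriv f w)" if "w \<in> ball 0 1" for m w
    using that unfolding h_def norm_mult norm_power complex_mod_cnj
    by (intro mult_left_mono) (auto intro!: mult_left_le power_le_one)
  have h_int: "integrable disc_measure (h m)" for m
    unfolding h_def
    using integral_power_series_mult_cnj_power(1)[OF deriv_taylor_sums[OF hol] I] by simp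
  \<comment> \<open>One factor \<open>m+1\<close> comes from \<open>deriv g\<close> through
    \<open>b m\<close>, the other from \<open>deriv f\<close>; together they cancel the
    moment.\<close>
  have h_val: "integral\<^sup>L disc_measure (h m) = taylor_coeff g (Suc m) * taylor_coeff f (Suc m) * z ^ m" for m
  proof -
    have "integral\<^sup>L disc_measure (h m) = b m * (of_nat (Suc m) * taylor_coeff f (Suc m) / (of_nat m + 1)\<^sup>2)"
      unfolding h_def
      using integral_power_series_mult_cnj_power(2)[OF deriv_taylor_sums[OF hol] I] by simp
    moreover have "of_nat m + 1 = (of_nat (Suc m) :: complex)" by simp
    ultimately show ?thesis
      by (simp add: b_def power2_eq_square del: of_nat_Suc)
  qed
  have h_sums: "(\<Sum>m. h m w) = deriv f w * deriv g (z * cnj w)" if "w \<in> ball 0 1" for w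
  proof -
    have "(\<lambda>m. deriv f w * (of_nat (Suc m) * taylor_coeff g (Suc m) * (z * cnj w) ^ m))
        sums (deriv f w * deriv g (z * cnj w))"
      by (intro sums_mult deriv_taylor_sums[OF g] zw that)
    moreover have "h m w = deriv f w * (of_nat (Suc m) * taylor_coeff g (Suc m) * (z * cnj w) ^ m)" for m
      by (simp add: h_def b_def power_mult_distrib del: of_nat_Suc)
    ultimately show ?thesis by (simp add: sums_iff)
  qed
  have "(\<lambda>m. integral\<^sup>L disc_measure (h m)) sums (\<integral>w. (\<Sum>m. h m w) \<partial>disc_measure)"
  proof (rule sums_integral[OF h_int])
    show "AE w in disc_measure. summable (\<lambda>m. norm (h m w))"
      using h_bound by (intro AE_I2 summable_comparison_test'[OF summable_mult2[OF b_sum]]) auto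
    show "summable (\<lambda>m. \<integral>w. norm (h m w) \<partial>disc_measure)"
    proof (rule summable_comparison_test'[OF summable_mult2[OF b_sum]])
      fix m
      have "(\<integral>w. norm (h m w) \<partial>disc_measure) \<le> (\<integral>w. cmod (b m) * cmod (deriv f w) \<partial>disc_measure)"
        using h_bound by (intro integral_mono integrable_norm h_int integrable_mult_right I1) auto
      then show "norm (\<integral>w. norm (h m w) \<partial>disc_measure) \<le> cmod (b m) * (\<integral>w. cmod (deriv f w) \<partial>disc_measure)"
        by simp
    qed
  qed
  also have "(\<integral>w. (\<Sum>m. h m w) \<partial>disc_measure) = (\<integral>w. deriv f w * deriv g (z * cnj w) \<partial>disc_measure)"
    by (intro Bochner_Integration.integral_cong) (auto simp: h_sums)
  also have "\<dots> = (LINT w:ball 0 1|lborel. deriv f w * deriv g (z * cnj w) * of_real (H2_weight w)) / of_real pi"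
  proof -
    have "(\<lambda>w. deriv f w * deriv g (z * cnj w)) \<in> borel_measurable disc_measure"
      by (intro borel_measurable_disc_measure_continuous continuous_intros
          continuous_on_compose2[OF holomorphic_on_imp_continuous_on[OF holomorphic_deriv[OF g]]]
          holomorphic_on_imp_continuous_on[OF holomorphic_deriv[OF hol]]) (use zw in auto)
    then show ?thesis
      by (subst integral_disc_measure) (simp_all add: scaleR_conv_of_real divide_inverse mult_ac)
  qed
  finally have "(\<lambda>m. z * (taylor_coeff g (Suc m) * taylor_coeff f (Suc m) * z ^ m)) sums
      (z * ((LINT w:ball 0 1|lborel. deriv f w * deriv g (z * cnj w) * of_real (H2_weight w)) / of_real pi))"
    unfolding h_val by (rule sums_mult)
  then have "(\<lambda>m. taylor_coeff g (Suc m) * taylor_coeff f (Suc m) * z ^ Suc m) sums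
      (z * (LINT w:ball 0 1|lborel. deriv f w * deriv g (z * cnj w) * of_real (H2_weight w)) / of_real pi)"
    by (simp add: mult_ac)
  from sums_Suc[OF this] show ?thesis
    by (simp add: taylor_coeff_0 add.commute)
qed

subsection \<open>Distributions with bounded Fourier coefficients\<close>

lemma test_fun_continuous:
  assumes "test_fun \<phi>"
  shows "continuous_on A (nderiv k \<phi>)"
  using assms unfolding test_fun_def
  by (metis continuous_at_imp_continuous_on differentiable_imp_continuous_within)

lemma test_fun_nderiv_periodic:
  assumes "test_fun \<phi>"
  shows "nderiv k \<phi> (x + 2 * pi) = nderiv k \<phi> x"
proof (induction k arbitrary: x)
  case 0
  then show ?case using assms by (simp add: test_fun_def)
next
  case (Suc k)
  have "(nderiv k \<phi> has_vector_derivative nderiv (Suc k) \<phi> (x + 2 * pi)) (at (x + 2 * pi))"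
    using assms by (simp add: test_fun_def vector_derivative_works)
  then have "((nderiv k \<phi> \<circ> (\<lambda>x. x + 2 * pi)) has_vector_derivative nderiv (Suc k) \<phi> (x + 2 * pi)) (at x)"
    using vector_diff_chain_at[of "\<lambda>x. x + 2 * pi" 1 x "nderiv k \<phi>" "nderiv (Suc k) \<phi> (x + 2 * pi)"]
    by (simp add: has_vector_derivative_add_const)
  moreover have "nderiv k \<phi> \<circ> (\<lambda>x. x + 2 * pi) = nderiv k \<phi>"
    using Suc by auto
  ultimately show ?case
    by (simp add: vector_derivative_at)
qed

text \<open>A real \<open>Sup\<close> bounds the values only when the set is bounded above.
  Periodicity reduces the range to that of one compact period, and continuity does the rest.\<close>

lemma test_fun_bdd_above:
  assumes "test_fun \<phi>"
  shows "bdd_above (range (\<lambda>x. cmod (nderiv k \<phi> x)))"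
proof -
  have per: "nderiv k \<phi> (x + of_int n * (2 * pi)) = nderiv k \<phi> x" for x n
  proof (induction n rule: int_induct[of _ 0])
    case (step1 i)
    then show ?case
      using test_fun_nderiv_periodic[OF assms, of k "x + of_int i * (2 * pi)"] by (simp add: algebra_simps)
  next
    case (step2 i)
    then show ?case
      using test_fun_nderiv_periodic[OF assms, of k "x + of_int (i - 1) * (2 * pi)"] by (simp add: algebra_simps)
  qed simp
  have "compact ((\<lambda>x. cmod (nderiv k \<phi> x)) ` {0..2 * pi})"
    by (intro compact_continuous_image continuous_intros test_fun_continuous assms) auto
  then have "bdd_above ((\<lambda>x. cmod (nderiv k \<phi> x)) ` {0..2 * pi})"
    by (intro bounded_imp_bdd_above compact_imp_bounded)
  moreover have "range (\<lambda>x. cmod (nderiv k \<phi> x)) \<subseteq> (\<lambda>x. cmod (nderiv k \<phi> x)) ` {0..2 * pi}"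
  proof
    fix y assume "y \<in> range (\<lambda>x. cmod (nderiv k \<phi> x))"
    then obtain x where y: "y = cmod (nderiv k \<phi> x)" by auto
    define x' where "x' = x + of_int (- \<lfloor>x / (2 * pi)\<rfloor>) * (2 * pi)"
    have "x' \<in> {0..2 * pi}"
      using floor_divide_lower[of "2 * pi" x] floor_divide_upper[of "2 * pi" x]
      by (simp add: x'_def algebra_simps)
    moreover have "y = cmod (nderiv k \<phi> x')"
      unfolding y x'_def per ..
    ultimately show "y \<in> (\<lambda>x. cmod (nderiv k \<phi> x)) ` {0..2 * pi}" by blast
  qed
  ultimately show ?thesis
    by (rule bdd_above_mono)
qed

lemma nderiv_linear:
  assumes "test_fun \<phi>" "test_fun \<psi>"
  shows "nderiv k (\<lambda>x. a * \<phi> x + b * \<psi> x) = (\<lambda>x. a * nderiv k \<phi> x + b * nderiv k \<psi> x)"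
proof (induction k)
  case (Suc k)
  show ?case
  proof
    fix x
    have "((\<lambda>x. a * nderiv k \<phi> x + b * nderiv k \<psi> x) has_vector_derivative
        a * nderiv (Suc k) \<phi> x + b * nderiv (Suc k) \<psi> x) (at x)"
      using assms unfolding test_fun_def
      by (intro has_vector_derivative_add has_vector_derivative_mult_right)
        (simp_all add: vector_derivative_works)
    then show "nderiv (Suc k) (\<lambda>x. a * \<phi> x + b * \<psi> x) x = a * nderiv (Suc k) \<phi> x + b * nderiv (Suc k) \<psi> x"
      by (simp only: nderiv.simps Suc vector_derivative_at)
  qed
qed simp

section \<open>Exponentials: derivatives and Fourier coefficients\<close>

lemma has_vector_derivative_cis_linear:
  "((\<lambda>\<theta>. cis (a * \<theta>)) has_vector_derivative (\<i> * of_real a) * cis (a * x)) (at x)"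
proof -
  have "((\<lambda>z. exp (\<i> * of_real a * z)) has_field_derivative \<i> * of_real a * exp (\<i> * of_real a * of_real x))
      (at (of_real x))"
    by (auto intro!: derivative_eq_intros)
  from has_vector_derivative_real_field[OF this] show ?thesis
    by (simp add: cis_conv_exp mult.assoc)
qed

lemma nderiv_cis: "nderiv k (\<lambda>\<theta>. cis (a * \<theta>)) = (\<lambda>\<theta>. (\<i> * of_real a) ^ k * cis (a * \<theta>))"
proof (induction k)
  case (Suc k)
  have "((\<lambda>\<theta>. (\<i> * of_real a) ^ k * cis (a * \<theta>)) has_vector_derivative
      (\<i> * of_real a) ^ Suc k * cis (a * x)) (at x)" for x
    using has_vector_derivative_mult_right[OF has_vector_derivative_cis_linear[of a x], of "(\<i> * of_real a) ^ k"]
    by (simp add: mult_ac)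
  from vector_derivative_at[OF this] show ?case
    by (simp only: nderiv.simps Suc)
qed simp

lemma fourier_coeff_cis: "fourier_coeff u m = u (\<lambda>\<theta>. cis (of_int (- m) * \<theta>))"
  by (simp add: fourier_coeff_def cis_conv_exp mult_ac)

text \<open>A bounded sequence \<open>c\<close> consists of the Fourier coefficients of \<open>c\<^sub>0\<close> plus the second
  distributional derivative of the continuous function \<open>- \<Sum> c\<^sub>m m\<^sup>-\<^sup>2 e\<^sup>i\<^sup>m\<^sup>\<theta>\<close>.\<close>

lemma periodic_distribution_of_bounded_coeffs:
  fixes c :: "nat \<Rightarrow> complex"
  assumes "\<And>m. cmod (c m) \<le> C"
  shows "\<exists>u. periodic_distribution u \<and> (\<forall>m. fourier_coeff u (int m) = c m)"
proof -
  \<comment> \<open>Differentiating \<open>cis (- m \<theta>)\<close> twice produces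
    \<open>- m^2\<close>, which restores \<open>c m\<close> from \<open>e m\<close>. Frequency 0 is
    lost by differentiation and is supplied by the mean-value term of \<open>u\<close>.\<close>
  define e where "e = (\<lambda>m. if m = 0 then 0 else - c m / (of_nat m)\<^sup>2)"
  define h where "h = (\<lambda>\<theta>. \<Sum>m. e m * cis (real m * \<theta>))"
  define u :: "(real \<Rightarrow> complex) \<Rightarrow> complex" where
    "u = (\<lambda>\<phi>. (c 0 * integral\<^sup>L circle_measure \<phi>
        + (\<integral>\<theta>. h \<theta> * nderiv 2 \<phi> \<theta> \<partial>circle_measure)) / of_real (2 * pi))"
  have e_sum: "summable (\<lambda>m. cmod (e m))"
  proof (rule summable_comparison_test')
    show "summable (\<lambda>m. C * inverse ((real m)\<^sup>2))"
      by (intro summable_mult inverse_power_summable) simp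
    show "norm (cmod (e m)) \<le> C * inverse ((real m)\<^sup>2)" for m
      using assms[of m] by (simp add: e_def norm_divide norm_power divide_simps)
  qed
  define S where "S = (\<Sum>m. cmod (e m))"
  have h_bound: "cmod (h \<theta>) \<le> S" for \<theta>
    unfolding h_def S_def
    by (rule order.trans[OF summable_norm]) (simp_all add: norm_mult e_sum)
  have S: "0 \<le> S" using h_bound[of 0] norm_ge_zero order.trans by blast
  have cis [measurable]: "cis \<in> borel_measurable borel"
    by (intro borel_measurable_continuous_onI continuous_intros)
  have h_meas [measurable]: "h \<in> borel_measurable borel"
    unfolding h_def by measurable
  have sup: "cmod (nderiv k \<phi> x) \<le> Sup (range (\<lambda>x. cmod (nderiv k \<phi> x)))" if "test_fun \<phi>" for \<phi> k x
    using test_fun_bdd_above[OF that] by (intro cSup_upper) auto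
  have meas: "nderiv k \<phi> \<in> borel_measurable borel" if "test_fun \<phi>" for \<phi> k
    using test_fun_continuous[OF that] by (rule borel_measurable_continuous_onI)
  have int: "integrable circle_measure (nderiv k \<phi>)" if "test_fun \<phi>" for \<phi> k
    using meas[OF that] sup[OF that] by (rule integrable_circle_measure_bounded)
  have int0: "integrable circle_measure \<phi>" if "test_fun \<phi>" for \<phi>
    using int[OF that, of 0] by simp
  have hbd: "cmod (h \<theta> * nderiv k \<phi> \<theta>) \<le> S * Sup (range (\<lambda>x. cmod (nderiv k \<phi> x)))" if "test_fun \<phi>" for \<phi> k \<theta>
    unfolding norm_mult using S sup[OF that] h_bound by (intro mult_mono) auto
  have inth: "integrable circle_measure (\<lambda>\<theta>. h \<theta> * nderiv k \<phi> \<theta>)" if "test_fun \<phi>" for \<phi> k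
    using meas[OF that, of k] by (intro integrable_circle_measure_bounded[OF _ hbd[OF that]]) simp
  have mean_bound: "cmod (integral\<^sup>L circle_measure F) \<le> 2 * pi * B"
    if "integrable circle_measure F" "\<And>\<theta>. cmod (F \<theta>) \<le> B" for F :: "real \<Rightarrow> complex" and B
  proof -
    have "cmod (integral\<^sup>L circle_measure F) \<le> (\<integral>\<theta>. cmod (F \<theta>) \<partial>circle_measure)"
      by (rule integral_norm_bound)
    also have "\<dots> \<le> (\<integral>\<theta>. B \<partial>circle_measure)"
      using that by (intro integral_mono integrable_norm finite_measure.integrable_const finite_measure_circle_measure)
    finally show ?thesis by (simp add: measure_circle_measure)
  qed
  have "periodic_distribution u"
    unfolding periodic_distribution_def
  proof (intro conjI allI impI exI)
    fix \<phi> \<psi> :: "real \<Rightarrow> complex" and a b :: complex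
    assume \<phi>: "test_fun \<phi>" and \<psi>: "test_fun \<psi>"
    have "(\<integral>\<theta>. a * \<phi> \<theta> + b * \<psi> \<theta> \<partial>circle_measure)
        = a * integral\<^sup>L circle_measure \<phi> + b * integral\<^sup>L circle_measure \<psi>"
      using int0[OF \<phi>] int0[OF \<psi>] by simp
    moreover have "(\<integral>\<theta>. h \<theta> * nderiv 2 (\<lambda>x. a * \<phi> x + b * \<psi> x) \<theta> \<partial>circle_measure)
        = a * (\<integral>\<theta>. h \<theta> * nderiv 2 \<phi> \<theta> \<partial>circle_measure) + b * (\<integral>\<theta>. h \<theta> * nderiv 2 \<psi> \<theta> \<partial>circle_measure)"
    proof -
      have "(\<integral>\<theta>. h \<theta> * nderiv 2 (\<lambda>x. a * \<phi> x + b * \<psi> x) \<theta> \<partial>circle_measure)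
          = (\<integral>\<theta>. a * (h \<theta> * nderiv 2 \<phi> \<theta>) + b * (h \<theta> * nderiv 2 \<psi> \<theta>) \<partial>circle_measure)"
        unfolding nderiv_linear[OF \<phi> \<psi>] by (simp add: algebra_simps)
      then show ?thesis
        using inth[OF \<phi>, of 2] inth[OF \<psi>, of 2] by simp
    qed
    ultimately show "u (\<lambda>x. a * \<phi> x + b * \<psi> x) = a * u \<phi> + b * u \<psi>"
      unfolding u_def by (simp only:) (simp add: field_simps)
  next
    fix \<phi> :: "real \<Rightarrow> complex"
    assume \<phi>: "test_fun \<phi>"
    define s where "s = (\<lambda>k. Sup (range (\<lambda>x. cmod (nderiv k \<phi> x))))"
    have s: "0 \<le> s k" for k
      using sup[OF \<phi>, of k 0] norm_ge_zero order.trans unfolding s_def by blast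
    \<comment> \<open>Only the seminorms of orders 0 and 2 occur, so \<open>u\<close> has order at
      most 2, with constant \<open>cmod (c 0) + S\<close>.\<close>
    have "cmod (u \<phi>) \<le> (cmod (c 0) * (2 * pi * s 0) + 2 * pi * (S * s 2)) / (2 * pi)"
      unfolding u_def norm_divide
    proof (rule frac_le)
      show "cmod (c 0 * integral\<^sup>L circle_measure \<phi> + (\<integral>\<theta>. h \<theta> * nderiv 2 \<phi> \<theta> \<partial>circle_measure))
          \<le> cmod (c 0) * (2 * pi * s 0) + 2 * pi * (S * s 2)"
        using mean_bound[OF int0[OF \<phi>] sup[OF \<phi>, of 0, simplified]]
          mean_bound[OF inth[OF \<phi>, of 2] hbd[OF \<phi>]]
        by (intro order.trans[OF norm_triangle_ineq] add_mono) (simp_all add: norm_mult s_def mult_left_mono)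
    qed (auto intro!: add_nonneg_nonneg mult_nonneg_nonneg s S)
    also have "\<dots> = cmod (c 0) * s 0 + S * s 2"
      by (simp add: add_divide_distrib)
    also have "\<dots> \<le> (cmod (c 0) + S) * (\<Sum>k\<le>2. s k)"
    proof -
      have "cmod (c 0) * s 0 + S * s 2 \<le> cmod (c 0) * (\<Sum>k\<le>2. s k) + S * (\<Sum>k\<le>2. s k)"
        using s S by (intro add_mono mult_left_mono member_le_sum) auto
      then show ?thesis by (simp add: distrib_right)
    qed
    finally show "cmod (u \<phi>) \<le> (cmod (c 0) + S) * (\<Sum>k\<le>2. Sup (range (\<lambda>x. cmod (nderiv k \<phi> x))))"
      unfolding s_def .
  qed
  moreover have "fourier_coeff u (int m) = c m" for m
  proof -
    have 1: "integral\<^sup>L circle_measure (\<lambda>\<theta>. cis (of_int (- int m) * \<theta>)) = (if m = 0 then 2 * of_real pi else 0)"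
      by (subst integral_circle_measure_cis) simp
    have "(\<integral>\<theta>. h \<theta> * nderiv 2 (\<lambda>\<theta>. cis (of_int (- int m) * \<theta>)) \<theta> \<partial>circle_measure)
        = (\<integral>\<theta>. - (of_nat m)\<^sup>2 * ((\<Sum>n. e n * cis (real n * \<theta>)) * cis (- (of_int (int m) * \<theta>))) \<partial>circle_measure)"
      unfolding nderiv_cis h_def by (simp add: power_mult_distrib mult_ac)
    also have "\<dots> = - (of_nat m)\<^sup>2 * (2 * of_real pi * e m)"
      by (subst integral_mult_right_zero, subst integral_circle_measure_series[OF e_sum]) simp
    finally show ?thesis
      unfolding fourier_coeff_cis u_def 1 by (simp add: e_def)
  qed
  ultimately show ?thesis by blast
qed

subsection \<open>Radial operators\<close>

lemma taylor_coeff_add: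
  assumes "f holomorphic_on ball 0 1" "g holomorphic_on ball 0 1"
  shows "taylor_coeff (\<lambda>z. f z + g z) = (\<lambda>n. taylor_coeff f n + taylor_coeff g n)"
proof (rule taylor_coeff_unique)
  fix z :: complex assume z: "z \<in> ball 0 1"
  show "(\<lambda>n. (taylor_coeff f n + taylor_coeff g n) * z ^ n) sums (f z + g z)"
    unfolding distrib_right using assms z by (intro sums_add taylor_coeff_sums)
qed

lemma taylor_coeff_cmult:
  assumes "f holomorphic_on ball 0 1"
  shows "taylor_coeff (\<lambda>z. c * f z) = (\<lambda>n. c * taylor_coeff f n)"
proof (rule taylor_coeff_unique)
  fix z :: complex assume z: "z \<in> ball 0 1"
  show "(\<lambda>n. c * taylor_coeff f n * z ^ n) sums (c * f z)"
    unfolding mult.assoc using assms z by (intro sums_mult taylor_coeff_sums)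
qed

lemma
  assumes f: "f \<in> H2" and l: "cmod l = 1"
  shows rot_H2: "rot l f \<in> H2"
    and taylor_coeff_rot: "taylor_coeff (rot l f) = (\<lambda>n. l ^ n * taylor_coeff f n)"
proof -
  have sums: "(\<lambda>n. (l ^ n * taylor_coeff f n) * z ^ n) sums rot l f z" if "z \<in> ball 0 1" for z
  proof -
    have "(\<lambda>n. taylor_coeff f n * (l * z) ^ n) sums f (l * z)"
      using that l by (intro taylor_coeff_sums H2_holomorphic f) (simp add: norm_mult)
    then show ?thesis
      by (simp add: rot_def power_mult_distrib mult_ac)
  qed
  show coeff: "taylor_coeff (rot l f) = (\<lambda>n. l ^ n * taylor_coeff f n)"
    by (rule taylor_coeff_unique[OF sums])
  have "rot l f holomorphic_on ball 0 1"
    by (rule power_series_holomorphic[of _ _ "\<lambda>n. l ^ n * taylor_coeff f n"]) (simp add: sums)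
  moreover have "rot l f z = 0" if "z \<notin> ball 0 1" for z
    using that l H2_outside[OF f, of "l * z"] by (simp add: rot_def norm_mult)
  moreover have "cmod (l ^ n * taylor_coeff f n) = cmod (taylor_coeff f n)" for n
    using l by (simp add: norm_mult norm_power)
  ultimately show "rot l f \<in> H2"
    using f by (simp add: H2_iff coeff)
qed

text \<open>The zero branch follows the convention that elements of \<open>H2\<close> vanish off the
  disc.\<close>

definition H2_series :: "(nat \<Rightarrow> complex) \<Rightarrow> complex \<Rightarrow> complex" where
  "H2_series a z = (if z \<in> ball 0 1 then \<Sum>n. a n * z ^ n else 0)"

lemma
  assumes a: "summable (\<lambda>n. (cmod (a n))\<^sup>2)"
  shows H2_series_H2: "H2_series a \<in> H2"
    and taylor_coeff_H2_series: "taylor_coeff (H2_series a) = a"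
proof -
  have sums: "(\<lambda>n. a n * z ^ n) sums H2_series a z" if z: "z \<in> ball 0 1" for z
  proof -
    \<comment> \<open>Convergence follows from \<open>x y \<le> x^2 + y^2\<close>: one square is
      summable by assumption, the other is geometric.\<close>
    have "summable (\<lambda>n. (cmod (a n))\<^sup>2 + ((cmod z)\<^sup>2) ^ n)"
      using z by (intro summable_add a summable_geometric) (simp add: power_less_one_iff)
    then have "summable (\<lambda>n. a n * z ^ n)"
    proof (rule summable_comparison_test')
      fix n
      have "cmod (a n) * cmod z ^ n \<le> (cmod (a n))\<^sup>2 + (cmod z ^ n)\<^sup>2"
      proof -
        have "0 \<le> cmod (a n) * cmod z ^ n" by simp
        then show ?thesis
          using sum_squares_bound[of "cmod (a n)" "cmod z ^ n"] by linarith
      qed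
      moreover have "(cmod z ^ n)\<^sup>2 = ((cmod z)\<^sup>2) ^ n"
        by (rule trans[OF power_even_eq[symmetric] power_mult])
      ultimately show "norm (a n * z ^ n) \<le> (cmod (a n))\<^sup>2 + ((cmod z)\<^sup>2) ^ n"
        by (simp add: norm_mult norm_power)
    qed
    then show ?thesis
      using z by (simp add: H2_series_def summable_sums)
  qed
  show coeff: "taylor_coeff (H2_series a) = a"
    by (rule taylor_coeff_unique[OF sums])
  have "H2_series a holomorphic_on ball 0 1"
    by (rule power_series_holomorphic[of _ _ a]) (simp add: sums)
  then show "H2_series a \<in> H2"
    unfolding H2_iff coeff using a by (auto simp: H2_series_def)
qed

lemma H2_series_taylor_coeff: "f \<in> H2 \<Longrightarrow> H2_series (taylor_coeff f) = f"
  using H2_iff[of f] by (intro H2_eqI H2_series_H2 taylor_coeff_H2_series) auto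

lemma summable_tail_coeffs:
  "summable (\<lambda>k. (cmod (a k))\<^sup>2) \<Longrightarrow> summable (\<lambda>k. (cmod (if k < n then 0 else a k))\<^sup>2)"
  by (rule summable_comparison_test'[of _ 0]) auto

text \<open>The squared norms are the tails of a convergent series; in substance this is the density
  of polynomials in H^2.\<close>

lemma H2_norm_tail_tendsto_0:
  assumes a: "summable (\<lambda>k. (cmod (a k))\<^sup>2)"
  shows "(\<lambda>n. H2_norm (H2_series (\<lambda>k. if k < n then 0 else a k))) \<longlonglongrightarrow> 0"
proof -
  have "(H2_norm (H2_series (\<lambda>k. if k < n then 0 else a k)))\<^sup>2 = (\<Sum>k. (cmod (a (k + n)))\<^sup>2)" for n
  proof -
    have "(\<lambda>k. (cmod (if k < n then 0 else a k))\<^sup>2) sums (H2_norm (H2_series (\<lambda>k. if k < n then 0 else a k)))\<^sup>2"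
      using H2_norm_sums[OF H2_series_H2[OF summable_tail_coeffs[OF a]], of n]
      by (simp add: taylor_coeff_H2_series[OF summable_tail_coeffs[OF a]])
    from sums_split_initial_segment[OF this, of n] show ?thesis
      by (simp add: sums_iff)
  qed
  then have "(\<lambda>n. (H2_norm (H2_series (\<lambda>k. if k < n then 0 else a k)))\<^sup>2) \<longlonglongrightarrow> 0"
    using suminf_exist_split2[OF a] by simp
  from tendsto_real_sqrt[OF this] show ?thesis
    by (simp add: H2_norm_nonneg H2_series_H2[OF summable_tail_coeffs[OF a]])
qed

lemma H2_linear_H2: "H2_linear R \<Longrightarrow> f \<in> H2 \<Longrightarrow> R f \<in> H2"
  and H2_linear_add: "H2_linear R \<Longrightarrow> f \<in> H2 \<Longrightarrow> g \<in> H2 \<Longrightarrow> R (\<lambda>z. f z + g z) = (\<lambda>z. R f z + R g z)"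
  and H2_linear_cmult: "H2_linear R \<Longrightarrow> f \<in> H2 \<Longrightarrow> R (\<lambda>z. c * f z) = (\<lambda>z. c * R f z)"
  by (simp_all add: H2_linear_def)

text \<open>The power \<open>z^n\<close> cut off outside the disc; the series form gives its
  coefficients at once.\<close>

definition H2_monom :: "nat \<Rightarrow> complex \<Rightarrow> complex" where
  "H2_monom n = H2_series (\<lambda>k. if k = n then 1 else 0)"

lemma
  shows H2_monom_H2: "H2_monom n \<in> H2"
    and taylor_coeff_H2_monom: "taylor_coeff (H2_monom n) = (\<lambda>k. if k = n then 1 else 0)"
    and H2_norm_monom: "H2_norm (H2_monom n) = 1"
proof -
  have sq: "(\<lambda>k. (cmod (if k = n then 1 else 0))\<^sup>2) sums 1"
  proof -
    have "(cmod (if k = n then 1 else 0))\<^sup>2 = (if k = n then 1 else 0)" for k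
      by simp
    then show ?thesis
      using sums_single[of n "\<lambda>_. 1::real"] by simp
  qed
  show H2: "H2_monom n \<in> H2"
    unfolding H2_monom_def using sq by (intro H2_series_H2) (simp add: sums_iff)
  show coeff: "taylor_coeff (H2_monom n) = (\<lambda>k. if k = n then 1 else 0)"
    unfolding H2_monom_def using sq by (intro taylor_coeff_H2_series) (simp add: sums_iff)
  have "(H2_norm (H2_monom n))\<^sup>2 = 1"
    using H2_norm_sums[OF H2, unfolded coeff] sq sums_unique2 by blast
  then show "H2_norm (H2_monom n) = 1"
    using H2_norm_nonneg[OF H2] by (simp add: power2_eq_1_iff)
qed

text \<open>Rotating before \<open>R\<close> multiplies the result by \<open>l^n\<close>; rotating
  after \<open>R\<close> multiplies the coefficient of index \<open>k\<close> by \<open>l^k\<close>.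
  One rotation that separates the two values forces the coefficient to vanish.\<close>

lemma radial_monom_coeff:
  assumes R: "H2_linear R" "H2_radial R" and kn: "k \<noteq> n"
  shows "taylor_coeff (R (H2_monom n)) k = 0"
proof -
  \<comment> \<open>the rotation is chosen such that \<open>l\<^sup>k = - l\<^sup>n\<close>\<close>
  define x where "x = pi / (real k - real n)"
  define l where "l = cis x"
  have l: "cmod l = 1" by (simp add: l_def)
  have "real k * x = real n * x + pi"
    using kn by (simp add: x_def field_simps)
  then have "l ^ k = - (l ^ n)"
    unfolding l_def Complex.DeMoivre by (simp flip: cis_mult)
  have RH: "R (H2_monom n) \<in> H2"
    using R(1) H2_monom_H2 by (rule H2_linear_H2)
  have "rot l (H2_monom n) = (\<lambda>z. l ^ n * H2_monom n z)"
  proof (rule H2_eqI)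
    show coeff: "taylor_coeff (rot l (H2_monom n)) = taylor_coeff (\<lambda>z. l ^ n * H2_monom n z)"
      by (auto simp: taylor_coeff_rot[OF H2_monom_H2 l] taylor_coeff_cmult H2_holomorphic H2_monom_H2
          taylor_coeff_H2_monom)
    show rH: "rot l (H2_monom n) \<in> H2"
      by (rule rot_H2[OF H2_monom_H2 l])
    show "(\<lambda>z. l ^ n * H2_monom n z) \<in> H2"
      using rH H2_monom_H2[of n] unfolding H2_iff coeff
      by (auto intro!: holomorphic_intros)
  qed
  then have "rot l (R (H2_monom n)) = (\<lambda>z. l ^ n * R (H2_monom n) z)"
    using R(2)[unfolded H2_radial_def, rule_format, OF l H2_monom_H2[of n]]
    by (simp only: H2_linear_cmult[OF R(1) H2_monom_H2])
  then have "taylor_coeff (rot l (R (H2_monom n))) k = l ^ n * taylor_coeff (R (H2_monom n)) k"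
    by (simp add: taylor_coeff_cmult[OF H2_holomorphic[OF RH]])
  then have "- (l ^ n) * taylor_coeff (R (H2_monom n)) k = l ^ n * taylor_coeff (R (H2_monom n)) k"
    using \<open>l ^ k = - (l ^ n)\<close> by (simp add: taylor_coeff_rot[OF RH l])
  moreover have "l \<noteq> 0" using l by auto
  ultimately show ?thesis by simp
qed

text \<open>Monomials are removed from \<open>f\<close> one at a time. Only the removal of degree
  \<open>k\<close> changes the coefficient of index \<open>k\<close> of the image, and boundedness
  makes the contribution of the remaining tail disappear in the limit.\<close>

lemma bounded_radial_multiplier:
  assumes R: "H2_linear R" "H2_radial R" and bound: "\<And>f. f \<in> H2 \<Longrightarrow> H2_norm (R f) \<le> C * H2_norm f"
    and f: "f \<in> H2"
  shows "taylor_coeff (R f) k = taylor_coeff (R (H2_monom k)) k * taylor_coeff f k"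
proof -
  define a where "a = taylor_coeff f"
  \<comment> \<open>\<open>T n\<close> is \<open>f\<close> minus its Taylor polynomial of degree
    below \<open>n\<close>. Given as a series, it is in \<open>H2\<close> with known coefficients,
    and linearity is needed for two summands only.\<close>
  define T where "T = (\<lambda>n. H2_series (\<lambda>k. if k < n then 0 else a k))"
  have a: "summable (\<lambda>k. (cmod (a k))\<^sup>2)"
    using f by (simp add: a_def H2_iff)
  have T: "T n \<in> H2" "taylor_coeff (T n) = (\<lambda>k. if k < n then 0 else a k)" for n
    unfolding T_def
    by (rule H2_series_H2[OF summable_tail_coeffs[OF a]], rule taylor_coeff_H2_series[OF summable_tail_coeffs[OF a]])
  have RT: "R (T n) \<in> H2" for n
    by (rule H2_linear_H2[OF R(1) T(1)])
  have RM: "R (H2_monom n) \<in> H2" for n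
    by (rule H2_linear_H2[OF R(1) H2_monom_H2])
  have aM: "(\<lambda>z. c * H2_monom n z) \<in> H2" for n c
    using H2_monom_H2[of n] unfolding H2_iff
    by (auto simp: taylor_coeff_cmult H2_holomorphic H2_monom_H2 norm_mult power_mult_distrib
        intro!: holomorphic_intros)
  have peel: "T n = (\<lambda>z. a n * H2_monom n z + T (Suc n) z)" for n
  proof (rule H2_eqI[OF T(1)])
    have hol: "(\<lambda>z. a n * H2_monom n z) holomorphic_on ball 0 1" "T (Suc n) holomorphic_on ball 0 1"
      using aM T(1) H2_holomorphic by blast+
    show coeff: "taylor_coeff (T n) = taylor_coeff (\<lambda>z. a n * H2_monom n z + T (Suc n) z)"
      unfolding taylor_coeff_add[OF hol] taylor_coeff_cmult[OF H2_holomorphic[OF H2_monom_H2]]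
      unfolding T taylor_coeff_H2_monom by (intro ext) (auto simp: less_Suc_eq)
    show "(\<lambda>z. a n * H2_monom n z + T (Suc n) z) \<in> H2"
      using T(1)[of n] hol aM[of "a n" n] T(1)[of "Suc n"] unfolding H2_iff coeff
      by (auto intro!: holomorphic_on_add)
  qed
  have peel_coeff: "taylor_coeff (R (T n)) k
      = (if n = k then a n * taylor_coeff (R (H2_monom n)) n else 0) + taylor_coeff (R (T (Suc n))) k" for n
  proof -
    have hol: "(\<lambda>z. a n * R (H2_monom n) z) holomorphic_on ball 0 1"
      using RM[of n, THEN H2_holomorphic] by (intro holomorphic_intros)
    have "R (T n) = (\<lambda>z. a n * R (H2_monom n) z + R (T (Suc n)) z)"
      by (subst peel) (simp only: H2_linear_add[OF R(1) aM T(1)] H2_linear_cmult[OF R(1) H2_monom_H2])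
    then show ?thesis
      using radial_monom_coeff[OF R, of k n]
      by (simp add: taylor_coeff_add[OF hol H2_holomorphic[OF RT]] taylor_coeff_cmult[OF H2_holomorphic[OF RM]])
  qed
  have below: "taylor_coeff (R f) k = taylor_coeff (R (T n)) k" if "n \<le> k" for n
    using that
  proof (induction n)
    case 0
    have "T 0 = f" using H2_series_taylor_coeff[OF f] by (simp add: T_def a_def)
    then show ?case by simp
  next
    case (Suc n)
    then show ?case using peel_coeff[of n] by simp
  qed
  have above: "taylor_coeff (R f) k = a k * taylor_coeff (R (H2_monom k)) k + taylor_coeff (R (T n)) k"
    if "Suc k \<le> n" for n
    using that
  proof (induction n rule: dec_induct)
    case base
    then show ?case using below[of k] peel_coeff[of k] by simp
  next
    case (step n)
    then show ?case using peel_coeff[of n] by simp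
  qed
  \<comment> \<open>A coefficient is at most the norm, \<open>R\<close> enlarges norms at most by
    \<open>C\<close>, and the tails tend to 0. Since the sequence is constant beyond
    \<open>k\<close>, that constant must be 0.\<close>
  have "(\<lambda>n. taylor_coeff (R (T n)) k) \<longlonglongrightarrow> 0"
  proof (rule Lim_null_comparison)
    show "\<forall>\<^sub>F n in sequentially. cmod (taylor_coeff (R (T n)) k) \<le> C * H2_norm (T n)"
      by (intro always_eventually allI order.trans[OF norm_taylor_coeff_le_H2_norm[OF RT] bound[OF T(1)]])
    show "(\<lambda>n. C * H2_norm (T n)) \<longlonglongrightarrow> 0"
      using tendsto_mult_right_zero[OF H2_norm_tail_tendsto_0[OF a]] by (simp add: T_def)
  qed
  moreover have "\<forall>\<^sub>F n in sequentially.
      taylor_coeff (R (T n)) k = taylor_coeff (R f) k - a k * taylor_coeff (R (H2_monom k)) k"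
    using eventually_ge_at_top[of "Suc k"] by eventually_elim (simp add: above)
  ultimately have "(\<lambda>n. taylor_coeff (R f) k - a k * taylor_coeff (R (H2_monom k)) k) \<longlonglongrightarrow> 0"
    by (rule Lim_transform_eventually)
  then show ?thesis
    by (simp add: LIMSEQ_const_iff a_def mult.commute)
qed

subsection \<open>Multipliers\<close>

lemma summable_bounded_power_series:
  fixes c :: "nat \<Rightarrow> complex"
  assumes c: "\<And>m. cmod (c m) \<le> B" and z: "z \<in> ball 0 1"
  shows "summable (\<lambda>m. c m * z ^ m)"
proof (rule summable_comparison_test')
  show "summable (\<lambda>m. B * cmod z ^ m)"
    using z by (intro summable_mult summable_geometric) simp
  show "norm (c m * z ^ m) \<le> B * cmod z ^ m" for m
    unfolding norm_mult norm_power by (intro mult_right_mono c) simp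
qed

lemma coefficient_multiplier_bounded:
  assumes R: "H2_linear R" and c: "\<And>m. cmod (c m) \<le> B"
    and coeff: "\<And>f. f \<in> H2 \<Longrightarrow> taylor_coeff (R f) = (\<lambda>m. c m * taylor_coeff f m)"
  shows "H2_bounded R"
  unfolding H2_bounded_def
proof (intro exI ballI)
  fix f assume f: "f \<in> H2"
  have B: "0 \<le> B" by (rule order.trans[OF norm_ge_zero c])
  have "(H2_norm (R f))\<^sup>2 \<le> B\<^sup>2 * (H2_norm f)\<^sup>2"
  proof (rule sums_le)
    show "(cmod (taylor_coeff (R f) m))\<^sup>2 \<le> B\<^sup>2 * (cmod (taylor_coeff f m))\<^sup>2" for m
      unfolding coeff[OF f] norm_mult power_mult_distrib
      by (intro mult_right_mono power_mono c) simp_all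
    show "(\<lambda>m. (cmod (taylor_coeff (R f) m))\<^sup>2) sums (H2_norm (R f))\<^sup>2"
      by (rule H2_norm_sums[OF H2_linear_H2[OF R f]])
    show "(\<lambda>m. B\<^sup>2 * (cmod (taylor_coeff f m))\<^sup>2) sums (B\<^sup>2 * (H2_norm f)\<^sup>2)"
      by (rule sums_mult[OF H2_norm_sums[OF f]])
  qed
  then have "(H2_norm (R f))\<^sup>2 \<le> (B * H2_norm f)\<^sup>2"
    by (simp add: power_mult_distrib)
  then show "H2_norm (R f) \<le> B * H2_norm f"
    by (rule power2_le_imp_le) (simp add: B H2_norm_nonneg[OF f])
qed

lemma coefficient_multiplier_radial:
  assumes R: "H2_linear R"
    and coeff: "\<And>f. f \<in> H2 \<Longrightarrow> taylor_coeff (R f) = (\<lambda>m. c m * taylor_coeff f m)"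
  shows "H2_radial R"
  unfolding H2_radial_def
proof (intro allI impI ballI)
  fix l f assume l: "cmod l = 1" and f: "f \<in> H2"
  have Rf: "R f \<in> H2" and rf: "rot l f \<in> H2"
    by (rule H2_linear_H2[OF R f], rule rot_H2[OF f l])
  show "R (rot l f) = rot l (R f)"
  proof (rule H2_eqI)
    show "taylor_coeff (R (rot l f)) = taylor_coeff (rot l (R f))"
      by (simp add: coeff[OF rf] coeff[OF f] taylor_coeff_rot[OF f l] taylor_coeff_rot[OF Rf l] mult_ac)
  qed (simp_all add: H2_linear_H2[OF R rf] rot_H2[OF Rf l])
qed

section \<open>Characterization of bounded radial operators by distributions\<close>

theorem theorem5p2:
  fixes R :: "(complex \<Rightarrow> complex) \<Rightarrow> (complex \<Rightarrow> complex)"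
  assumes "H2_linear R"
  shows "(H2_bounded R \<and> H2_radial R) \<longleftrightarrow>
    (\<exists>u g. periodic_distribution u
       \<and> bdd_above (range (\<lambda>m::nat. cmod (fourier_coeff u (int m))))
       \<and> g holomorphic_on ball 0 1 \<and> induces u g
       \<and> (\<forall>f\<in>H2. \<forall>z\<in>ball 0 1.
            R f z = fourier_coeff u 0 * f 0
              + z * (LINT w:ball 0 1|lborel. deriv f w * deriv g (z * cnj w) * of_real (H2_weight w))
                  / of_real pi))"
proof
  assume "H2_bounded R \<and> H2_radial R"
  then obtain C where bound: "\<And>f. f \<in> H2 \<Longrightarrow> H2_norm (R f) \<le> C * H2_norm f" and rad: "H2_radial R"
    unfolding H2_bounded_def by blast
  \<comment> \<open>The diagonal entries of \<open>R\<close> in the monomial basis. Monomials have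
    norm 1, so the operator bound \<open>C\<close> also bounds \<open>c\<close>.\<close>
  define c where "c = (\<lambda>n. taylor_coeff (R (H2_monom n)) n)"
  have c: "cmod (c n) \<le> C" for n
  proof -
    have "cmod (c n) \<le> H2_norm (R (H2_monom n))"
      unfolding c_def by (rule norm_taylor_coeff_le_H2_norm[OF H2_linear_H2[OF assms H2_monom_H2]])
    also have "\<dots> \<le> C"
      using bound[OF H2_monom_H2, of n] by (simp add: H2_norm_monom)
    finally show ?thesis .
  qed
  obtain u where u: "periodic_distribution u" and "\<forall>m. fourier_coeff u (int m) = c m"
    using periodic_distribution_of_bounded_coeffs[of c, OF c] by (elim exE conjE)
  then have uc: "fourier_coeff u (int m) = c m" for m
    by simp
  define g where "g = (\<lambda>z. \<Sum>m. c m * z ^ m)"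
  have g: "(\<lambda>m. c m * z ^ m) sums g z" if "z \<in> ball 0 1" for z
    unfolding g_def by (intro summable_sums summable_bounded_power_series[OF c that])
  have g_hol: "g holomorphic_on ball 0 1"
    by (rule power_series_holomorphic[of _ _ c]) (simp add: g)
  have g_coeff: "taylor_coeff g = c"
    by (rule taylor_coeff_unique[OF g])
  \<comment> \<open>Both sides are sums of the same power series: the left by the multiplier
    property of \<open>R\<close>, the right by termwise integration.\<close>
  have formula: "\<forall>f\<in>H2. \<forall>z\<in>ball 0 1. R f z = fourier_coeff u 0 * f 0
      + z * (LINT w:ball 0 1|lborel. deriv f w * deriv g (z * cnj w) * of_real (H2_weight w)) / of_real pi"
  proof (intro ballI, rule sums_unique2)
    fix f and z :: complex assume f: "f \<in> H2" and z: "z \<in> ball 0 1"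
    show "(\<lambda>m. c m * taylor_coeff f m * z ^ m) sums R f z"
      using taylor_coeff_sums[OF H2_holomorphic[OF H2_linear_H2[OF assms f]] z]
      by (simp only: bounded_radial_multiplier[OF assms rad bound f] c_def)
    show "(\<lambda>m. c m * taylor_coeff f m * z ^ m) sums (fourier_coeff u 0 * f 0
      + z * (LINT w:ball 0 1|lborel. deriv f w * deriv g (z * cnj w) * of_real (H2_weight w)) / of_real pi)"
      using integral_formula_sums[OF f g_hol z] by (simp only: g_coeff uc[of 0, unfolded of_nat_0])
  qed
  have bdd: "bdd_above (range (\<lambda>m::nat. cmod (fourier_coeff u (int m))))"
    unfolding uc by (rule bdd_aboveI2[OF c])
  have ug: "induces u g"
    unfolding induces_def uc using g by (rule ballI)
  show "\<exists>u g. periodic_distribution u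
       \<and> bdd_above (range (\<lambda>m::nat. cmod (fourier_coeff u (int m))))
       \<and> g holomorphic_on ball 0 1 \<and> induces u g
       \<and> (\<forall>f\<in>H2. \<forall>z\<in>ball 0 1.
            R f z = fourier_coeff u 0 * f 0
              + z * (LINT w:ball 0 1|lborel. deriv f w * deriv g (z * cnj w) * of_real (H2_weight w))
                  / of_real pi)"
    by (intro exI[of _ u] exI[of _ g] conjI u bdd g_hol ug formula)
next
  assume "\<exists>u g. periodic_distribution u
       \<and> bdd_above (range (\<lambda>m::nat. cmod (fourier_coeff u (int m))))
       \<and> g holomorphic_on ball 0 1 \<and> induces u g
       \<and> (\<forall>f\<in>H2. \<forall>z\<in>ball 0 1.
            R f z = fourier_coeff u 0 * f 0
              + z * (LINT w:ball 0 1|lborel. deriv f w * deriv g (z * cnj w) * of_real (H2_weight w))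
                  / of_real pi)"
  then show "H2_bounded R \<and> H2_radial R"
  proof (elim exE conjE)
    fix u g
    assume bdd: "bdd_above (range (\<lambda>m::nat. cmod (fourier_coeff u (int m))))"
      and g: "g holomorphic_on ball 0 1" and ug: "induces u g"
      and formula: "\<forall>f\<in>H2. \<forall>z\<in>ball 0 1. R f z = fourier_coeff u 0 * f 0
        + z * (LINT w:ball 0 1|lborel. deriv f w * deriv g (z * cnj w) * of_real (H2_weight w)) / of_real pi"
    \<comment> \<open>Uniqueness of coefficients identifies the Taylor coefficients of
      \<open>g\<close> with the Fourier coefficients of \<open>u\<close>, so the integral formula
      exhibits \<open>R\<close> as a bounded multiplier.\<close>
    have g_coeff: "taylor_coeff g = (\<lambda>m. fourier_coeff u (int m))"
      using ug unfolding induces_def by (intro taylor_coeff_unique) (rule bspec)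
    obtain B where B: "\<And>m::nat. cmod (fourier_coeff u (int m)) \<le> B"
      using bdd unfolding bdd_above_def by blast
    have coeff: "taylor_coeff (R f) = (\<lambda>m. fourier_coeff u (int m) * taylor_coeff f m)" if f: "f \<in> H2" for f
    proof (rule taylor_coeff_unique)
      fix z :: complex assume z: "z \<in> ball 0 1"
      show "(\<lambda>m. fourier_coeff u (int m) * taylor_coeff f m * z ^ m) sums R f z"
        using integral_formula_sums[OF f g z] unfolding formula[rule_format, OF f z]
        by (simp only: g_coeff of_nat_0)
    qed
    show ?thesis
      by (intro conjI coefficient_multiplier_bounded[OF assms B coeff]
          coefficient_multiplier_radial[OF assms coeff])
  qed
qed

end
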